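(* For every $\epsilon>0$ there exists an integer $n_0$ such that for every $n>n_0$ and every normal subset $A\subseteq S_n$ with $\mu(A)\ge e^{-n^{2/5-\epsilon}}$, we have $A^2\supseteq A_n$.
   Context: A subset $A\subseteq S_n$ is normal if it is closed under conjugation by $S_n$ (i.e. a union of conjugacy classes). $\mu(A)=|A|/|S_n|$ is the density of $A$ in $S_n$. $A^2=\{xy:x,y\in A\}$. *)

theory Defs
  imports Complex_Main "HOL-Combinatorics.Permutations"
begin

definition symgrp :: "nat \<Rightarrow> (nat \<Rightarrow> nat) set" where
  "symgrp n = {p. p permutes {1..n}}"

definition altgrp :: "nat \<Rightarrow> (nat \<Rightarrow> nat) set" where
  "altgrp n = {p \<in> symgrp n. evenperm p}"

definition normal_subset :: "nat \<Rightarrow> (nat \<Rightarrow> nat) set \<Rightarrow> bool" where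
  "normal_subset n A \<longleftrightarrow> A \<subseteq> symgrp n \<and>
     (\<forall>g \<in> symgrp n. \<forall>x \<in> A. g \<circ> x \<circ> inv g \<in> A)"

definition density :: "nat \<Rightarrow> (nat \<Rightarrow> nat) set \<Rightarrow> real" where
  "density n A = real (card A) / real (card (symgrp n))"

definition set_square :: "(nat \<Rightarrow> nat) set \<Rightarrow> (nat \<Rightarrow> nat) set" where
  "set_square A = {x \<circ> y | x y. x \<in> A \<and> y \<in> A}"

end

(* A random permutation has more than k cycles with probability at most (n + 1) / 2^k, so A contains
   an element p with k <= c sqrt n cycles, and the longest of them has length N >= n / k >= C k. It
   remains to write every even t as s o s' with s and s' of the cycle type of p. The factorization is
   grown point by point: inserting a new point into one cycle of s and one cycle of s' either merges
   two cycles of t or splits one. The cycles of s are regarded as bins to be filled with cycles of t: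
   odd cycles and pairs of even cycles can be placed inside a single bin, and a cycle of t that does
   not fit is made to cross from its bin into the longest cycle of s, at a cost of boundedly many
   points of the latter per bin. Since N >= C k, the longest cycle can pay for all the bins. *)

theory Submission
  imports Defs "HOL-Library.Multiset" "HOL-Real_Asymp.Real_Asymp"
begin

section \<open>Cycle decompositions\<close>

text \<open>The construction is analysed backwards. In order of time the main bin, the longest
  cycle, comes first and holds product cycles in shortened form; later bins add whole cycles or
  prolong old ones. A goal is reduced by undoing its last step, so a long cycle appears to lose a
  piece to the current bin and to leave a shorter remainder for the earlier ones. Parity survives
  every step: prolongations have even length, odd cycles are removed singly and even ones in pairs.
  So the main bin finally receives the type of an even permutation, and such a type can be packed
  into one bin. Three obstacles shape the rest. A new fixed point of the product can enter a bin
  only if the bin is empty or has a point that lies in it for both factors. A bin with one free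
  point cannot absorb part of a cycle in the usual way. Cycles of length at most 4 are too short to
  be absorbed by a larger bin, so they are used up in groups of equal length. The two demands on k
  fit together at order sqrt n: as 2/5 < 1/2, the bound (n + 1) / 2^k falls below the density, while
  n at least 261 k^2 makes N at least 261 k.\<close>

definition cyc :: "('a \<Rightarrow> 'a) \<Rightarrow> 'a list \<Rightarrow> bool" where
  "cyc p xs \<longleftrightarrow> xs \<noteq> [] \<and> distinct xs \<and> successively (\<lambda>a b. p a = b) xs \<and> p (last xs) = hd xs"

lemma cyc_rotate:
  assumes "cyc p (xs @ ys)"
  shows "cyc p (ys @ xs)"
proof (cases "xs = [] \<or> ys = []")
  case True
  then show ?thesis using assms by auto
next
  case False
  then show ?thesis using assms
    by (auto simp: cyc_def successively_append_iff)
qed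

lemma cyc_rotate_to_hd:
  assumes "cyc p xs" "x \<in> set xs"
  obtains ys where "cyc p (x # ys)" "mset (x # ys) = mset xs"
proof -
  obtain us vs where xs: "xs = us @ x # vs" using split_list[OF assms(2)] by blast
  have "cyc p ((x # vs) @ us)" using assms(1) cyc_rotate[of p us "x # vs"] xs by simp
  moreover have "mset ((x # vs) @ us) = mset xs" using xs by simp
  ultimately show thesis using that[of "vs @ us"] by simp
qed

text \<open>Leaving the last entry out of \<open>a\<close> and the first out of \<open>b\<close>
  matters: multiplication by a transposition changes a cycle just where it is closed up, from
  \<open>last xs\<close> to \<open>hd xs\<close>.\<close>

lemma successively_weaken:
  assumes "successively P xs"
    and "\<And>a b. a \<in> set (butlast xs) \<Longrightarrow> b \<in> set (tl xs) \<Longrightarrow> P a b \<Longrightarrow> Q a b"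
  shows "successively Q xs"
  using assms
proof (induction xs)
  case (Cons x xs)
  show ?case
  proof (cases xs)
    case (Cons y ys)
    have "successively Q xs"
    proof (rule Cons.IH)
      show "successively P xs" using Cons.prems(1) Cons by simp
      fix a b assume "a \<in> set (butlast xs)" "b \<in> set (tl xs)" "P a b"
      then show "Q a b" using Cons.prems(2)[of a b] Cons by (auto simp: split: if_splits)
    qed
    moreover have "Q x y" using Cons.prems(1) Cons.prems(2)[of x y] Cons by simp
    ultimately show ?thesis using Cons by simp
  qed simp
qed simp

lemma cyc_image:
  assumes "cyc p xs" "x \<in> set xs"
  shows "p x \<in> set xs"
proof -
  obtain ys where y: "cyc p (x # ys)" "mset (x # ys) = mset xs"
    using cyc_rotate_to_hd[OF assms] .
  then have "p x \<in> set (x # ys)" by (cases ys) (auto simp: cyc_def)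
  then show ?thesis using mset_eq_setD[OF y(2)] by blast
qed

lemma cyc_map:
  assumes "cyc p xs" "cyc q (map g xs)" "x \<in> set xs"
  shows "q (g x) = g (p x)"
proof -
  obtain us vs where xs: "xs = us @ x # vs" using split_list[OF assms(3)] by blast
  have p: "cyc p (x # vs @ us)" using assms(1) cyc_rotate[of p us "x # vs"] xs by simp
  have q: "cyc q (map g (x # vs @ us))"
    using assms(2) cyc_rotate[of q "map g us" "map g (x # vs)"] xs by simp
  show ?thesis
    by (cases "vs @ us") (use p q in \<open>auto simp: cyc_def\<close>)
qed

lemma cyc_insert_before:
  assumes "cyc q xs" "v \<in> set xs" "z \<notin> set xs" "q z = z"
  obtains ys where "cyc (transpose z v \<circ> q) ys" "mset ys = add_mset z (mset xs)"
proof -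
  obtain ys where y: "cyc q (v # ys)" "mset (v # ys) = mset xs"
    using cyc_rotate_to_hd[OF assms(1,2)] .
  have z: "z \<notin> set (v # ys)" using assms(3) mset_eq_setD[OF y(2)] by simp
  have "successively (\<lambda>a b. (transpose z v \<circ> q) a = b) (v # ys)"
    by (rule successively_weaken[where P = "\<lambda>a b. q a = b"])
      (use y(1) z in \<open>auto simp: cyc_def transpose_def\<close>)
  then have "cyc (transpose z v \<circ> q) (z # v # ys)"
    using y(1) z assms(4) by (auto simp: cyc_def)
  then show thesis using that y(2) by auto
qed

lemma cyc_transpose_outside:
  assumes "cyc q xs" "v \<notin> set xs" "z \<notin> set xs"
  shows "cyc (transpose z v \<circ> q) xs"
proof -
  have "successively (\<lambda>a b. (transpose z v \<circ> q) a = b) xs"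
    by (rule successively_weaken[where P = "\<lambda>a b. q a = b"])
      (use assms in \<open>auto simp: cyc_def transpose_def dest: list.set_sel(2)[rotated]\<close>)
  moreover have "hd xs \<in> set xs" using assms(1) by (simp add: cyc_def)
  ultimately show ?thesis using assms by (auto simp: cyc_def transpose_def)
qed

text \<open>The equation of multisets says at once that the cycles are disjoint and that they cover
  \<open>X\<close>. Fixed points are cycles of length 1, so \<open>size W\<close> counts
  them.\<close>

definition cycle_type_dec :: "('a \<Rightarrow> 'a) \<Rightarrow> 'a set \<Rightarrow> 'a list multiset \<Rightarrow> bool" where
  "cycle_type_dec p X W \<longleftrightarrow> finite X \<and> p permutes X \<and> (\<forall>w\<in>#W. cyc p w) \<and>
     (\<Sum>w\<in>#W. mset w) = mset_set X"

lemma cycle_type_dec_set: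
  assumes "cycle_type_dec p X W" "w \<in># W"
  shows "set w \<subseteq> X"
proof -
  have "mset w \<subseteq># mset_set X"
    using assms by (metis cycle_type_dec_def insert_DiffM mset_subset_eq_add_left image_mset_add_mset sum_mset.insert)
  then show ?thesis using assms(1)
    by (metis cycle_type_dec_def finite_set_mset_mset_set set_mset_mono set_mset_mset)
qed

lemma cycle_type_dec_cover:
  assumes "cycle_type_dec p X W" "x \<in> X"
  obtains w where "w \<in># W" "x \<in> set w"
proof -
  have "x \<in># (\<Sum>w\<in>#W. mset w)" using assms by (simp add: cycle_type_dec_def)
  then show thesis using that by (auto simp: in_Union_mset_iff)
qed

lemma cycle_type_dec_disjoint:
  assumes "cycle_type_dec p X (add_mset u W)" "w \<in># W"
  shows "set u \<inter> set w = {}"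
proof -
  obtain W' where W: "W = add_mset w W'" using assms(2) by (metis insert_DiffM)
  have "mset u + mset w \<subseteq># mset_set X"
    using assms(1) unfolding W cycle_type_dec_def by (metis (no_types, lifting) add.assoc image_mset_add_mset mset_subset_eq_add_left sum_mset.insert)
  then have "count (mset u) x + count (mset w) x \<le> count (mset_set X) x" for x
    by (metis count_union mset_subset_eq_count)
  moreover have "count (mset_set X) x \<le> 1" for x
    by (cases "finite X"; cases "x \<in> X") auto
  ultimately have le: "count (mset u) x + count (mset w) x \<le> 1" for x
    by (meson order_trans)
  have "\<not> (x \<in> set u \<and> x \<in> set w)" for x
  proof
    assume "x \<in> set u \<and> x \<in> set w"
    then have "0 < count (mset u) x" "0 < count (mset w) x" by simp_all
    then show False using le[of x] by linarith
  qed
  then show ?thesis by auto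
qed

lemma cycle_type_dec_insert_fixed:
  assumes "cycle_type_dec p X W" "z \<notin> X"
  shows "cycle_type_dec p (insert z X) (add_mset [z] W)"
proof -
  have "p permutes insert z X"
    using assms permutes_subset[of p X "insert z X"] by (auto simp: cycle_type_dec_def)
  moreover have "p z = z" using assms by (auto simp: cycle_type_dec_def permutes_not_in)
  ultimately show ?thesis using assms by (auto simp: cycle_type_dec_def cyc_def)
qed

lemma cycle_type_dec_insert_before:
  assumes d: "cycle_type_dec q X W" and z: "z \<notin> X" and v: "v \<in> X"
  obtains W' where "cycle_type_dec (transpose z v \<circ> q) (insert z X) W'" "size W' = size W"
proof -
  obtain w where w: "w \<in># W" "v \<in> set w" using cycle_type_dec_cover[OF d v] .
  obtain W0 where W: "W = add_mset w W0" using w(1) by (metis insert_DiffM)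
  have zw: "z \<notin> set w" using cycle_type_dec_set[OF d w(1)] z by auto
  have qz: "q z = z" using d z by (auto simp: cycle_type_dec_def permutes_not_in)
  have cw: "cyc q w" using d w(1) by (auto simp: cycle_type_dec_def)
  obtain y where y: "cyc (transpose z v \<circ> q) y" "mset y = add_mset z (mset w)"
    using cyc_insert_before[OF cw w(2) zw qz] .
  have "cyc (transpose z v \<circ> q) u" if "u \<in># W0" for u
  proof (rule cyc_transpose_outside)
    show "cyc q u" using d that W by (auto simp: cycle_type_dec_def)
    show "v \<notin> set u" using cycle_type_dec_disjoint[of q X w W0 u] d that W w(2) by auto
    show "z \<notin> set u" using cycle_type_dec_set[OF d, of u] that W z by auto
  qed
  moreover have "(transpose z v \<circ> q) permutes insert z X"
    using d v permutes_subset[of q X "insert z X"]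
    by (intro permutes_compose permutes_swap_id) (auto simp: cycle_type_dec_def)
  ultimately have "cycle_type_dec (transpose z v \<circ> q) (insert z X) (add_mset y W0)"
    using d y z W by (auto simp: cycle_type_dec_def)
  then show thesis using that W by simp
qed

text \<open>Multiplying by \<open>transpose a (p a)\<close> takes \<open>a\<close> out of its cycle.
  If \<open>a\<close> is fixed, the permutation stays the same and \<open>card X + size W\<close>
  changes by 2; otherwise the cycle is only shortened, and both parities change.\<close>

lemma cycle_type_dec_exists:
  assumes "finite X" "p permutes X"
  shows "\<exists>W. cycle_type_dec p X W \<and> (evenperm p \<longleftrightarrow> even (card X + size W))"
  using assms
proof (induction X arbitrary: p rule: finite_induct)
  case empty
  then show ?case by (auto simp: cycle_type_dec_def intro!: exI[of _ "{#}"])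
next
  case (insert a X)
  define q where "q = transpose a (p a) \<circ> p"
  have q: "q permutes X" unfolding q_def by (rule permutes_insert_lemma[OF insert.prems])
  have p: "p = transpose a (p a) \<circ> q" by (simp add: q_def o_assoc[symmetric] fun_eq_iff)
  obtain W where W: "cycle_type_dec q X W" "evenperm q \<longleftrightarrow> even (card X + size W)"
    using insert.IH[OF q] by blast
  have ev: "evenperm p \<longleftrightarrow> ((a = p a) \<longleftrightarrow> evenperm q)"
    using evenperm_comp[of "transpose a (p a)" q] permutation_swap_id[of a "p a"]
      permutation_permutes[of q] q insert.hyps(1) p by (auto simp: evenperm_swap)
  show ?case
  proof (cases "p a = a")
    case True
    then have "p = q" using p by (simp add: fun_eq_iff)
    then show ?thesis using cycle_type_dec_insert_fixed[OF W(1) insert.hyps(2)] W(2) insert.hyps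
      by (intro exI[of _ "add_mset [a] W"]) auto
  next
    case False
    have "p a \<in> X" using permutes_in_image[OF insert.prems, of a] False by auto
    from cycle_type_dec_insert_before[OF W(1) insert.hyps(2) this] p
    obtain W' where "cycle_type_dec p (insert a X) W'" "size W' = size W" by metis
    then show ?thesis using ev W(2) insert.hyps False by (intro exI[of _ W']) auto
  qed
qed

section \<open>Counting permutations with many cycles\<close>

definition many_cycles :: "'a set \<Rightarrow> nat \<Rightarrow> ('a \<Rightarrow> 'a) set" where
  "many_cycles X k = {p. p permutes X \<and> (\<forall>W. cycle_type_dec p X W \<longrightarrow> size W > k)}"

text \<open>Every permutation of \<open>insert a X\<close> is \<open>transpose a b \<circ> q\<close> with \<open>q\<close> permuting \<open>X\<close>, and it has one more
  cycle than \<open>q\<close> only for \<open>b = a\<close>; hence \<open>2 ^ (number of cycles)\<close> sums to \<open>(n + 1)!\<close> over \<open>S\<^sub>n\<close>.\<close>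

lemma card_many_cycles:
  assumes "finite X"
  shows "card (many_cycles X k) * 2 ^ k \<le> fact (Suc (card X))"
  using assms
proof (induction X arbitrary: k rule: finite_induct)
  case empty
  show ?case
  proof (cases k)
    case 0
    have "many_cycles {} 0 \<subseteq> {id :: 'a \<Rightarrow> 'a}" by (auto simp: many_cycles_def)
    from card_mono[OF _ this] show ?thesis using 0 by simp
  next
    case (Suc j)
    have "cycle_type_dec id {} {#}" by (simp add: cycle_type_dec_def)
    then have "many_cycles {} k = ({} :: ('a \<Rightarrow> 'a) set)"
      by (auto simp: many_cycles_def)
    then show ?thesis by simp
  qed
next
  case (insert a X)
  let ?n = "card X"
  show ?case
  proof (cases k)
    case 0
    have "many_cycles (insert a X) 0 \<subseteq> {p. p permutes insert a X}" by (auto simp: many_cycles_def)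
    then have "card (many_cycles (insert a X) 0) \<le> fact (Suc ?n)"
      using card_mono[OF finite_permutations[of "insert a X"]] card_permutations[of "insert a X" "Suc ?n"]
        insert.hyps by simp
    also have "\<dots> \<le> fact (Suc (Suc ?n))" by (rule fact_mono_nat) simp
    finally show ?thesis using 0 insert.hyps by simp
  next
    case (Suc j)
    have fin: "finite (many_cycles X i)" for i
      by (rule finite_subset[OF _ finite_permutations[OF insert.hyps(1)]]) (auto simp: many_cycles_def)
    have "many_cycles (insert a X) k \<subseteq> many_cycles X j \<union>
            (\<lambda>(b, q). transpose a b \<circ> q) ` (X \<times> many_cycles X k)" (is "_ \<subseteq> ?R")
    proof
      fix p assume p0: "p \<in> many_cycles (insert a X) k"
      then have pp: "p permutes insert a X" by (simp add: many_cycles_def)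
      define q where "q = transpose a (p a) \<circ> p"
      have q: "q permutes X" unfolding q_def by (rule permutes_insert_lemma[OF pp])
      have p: "p = transpose a (p a) \<circ> q" by (simp add: q_def o_assoc[symmetric] fun_eq_iff)
      show "p \<in> ?R"
      proof (cases "p a = a")
        case True
        then have pq: "p = q" using p by (simp add: fun_eq_iff)
        have "size W > j" if "cycle_type_dec q X W" for W
          using cycle_type_dec_insert_fixed[OF that insert.hyps(2)] p0 pq Suc
          by (force simp: many_cycles_def)
        then show ?thesis using q pq by (auto simp: many_cycles_def)
      next
        case False
        have pa: "p a \<in> X" using permutes_in_image[OF pp, of a] False by auto
        have "size W > k" if W: "cycle_type_dec q X W" for W
        proof -
          from cycle_type_dec_insert_before[OF W insert.hyps(2) pa] p
          obtain W' where "cycle_type_dec p (insert a X) W'" "size W' = size W" by metis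
          then show ?thesis using p0 by (auto simp: many_cycles_def)
        qed
        then have "q \<in> many_cycles X k" using q by (auto simp: many_cycles_def)
        then show ?thesis using pa p by (intro UnI2 image_eqI[of _ _ "(p a, q)"]) auto
      qed
    qed
    then have "card (many_cycles (insert a X) k) \<le> card ?R"
      using fin insert.hyps(1) by (intro card_mono) auto
    also have "\<dots> \<le> card (many_cycles X j) + card ((\<lambda>(b, q). transpose a b \<circ> q) ` (X \<times> many_cycles X k))"
      by (rule card_Un_le)
    also have "\<dots> \<le> card (many_cycles X j) + ?n * card (many_cycles X k)"
      using card_image_le[of "X \<times> many_cycles X k" "\<lambda>(b, q). transpose a b \<circ> q"] fin insert.hyps(1)
      by (simp add: card_cartesian_product)
    \<comment> \<open>The fixed-point case loses one cycle, whence \<open>2 ^ k = 2 * 2 ^ j\<close>;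
      the resulting factor \<open>2 + card X\<close> is the one by which the factorial
      grows.\<close>
    finally have "card (many_cycles (insert a X) k) * 2 ^ k
        \<le> 2 * (card (many_cycles X j) * 2 ^ j) + ?n * (card (many_cycles X k) * 2 ^ k)"
      using Suc mult_le_mono1[of _ _ "2 ^ k"] by (fastforce simp: algebra_simps)
    also have "\<dots> \<le> 2 * fact (Suc ?n) + ?n * fact (Suc ?n)"
      by (intro add_mono mult_le_mono insert.IH) auto
    also have "\<dots> = fact (Suc (Suc ?n))" by (simp add: algebra_simps)
    finally show ?thesis using insert.hyps by simp
  qed
qed

section \<open>Permutations of equal cycle type\<close>

lemma list_of_image_mset_eq:
  assumes "image_mset f (mset xs) = image_mset g M"
  obtains ys where "mset ys = M" "map f xs = map g ys"
  using assms
proof (induction xs arbitrary: M thesis)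
  case Nil
  then show ?case by simp
next
  case (Cons x xs)
  have "image_mset g M = add_mset (f x) (image_mset f (mset xs))" using Cons.prems(2) by simp
  then obtain y M' where y: "M = add_mset y M'" "g y = f x" "image_mset g M' = image_mset f (mset xs)"
    using msed_map_invR by metis
  obtain ys where "mset ys = M'" "map f xs = map g ys" using Cons.IH[of M'] y(3) by metis
  then show ?case using Cons.prems(1)[of "y # ys"] y by simp
qed

lemma mset_concat_sum: "mset (concat xss) = (\<Sum>xs\<in>#mset xss. mset xs)"
  by (induction xss) auto

lemma bij_of_distinct_lists:
  assumes "distinct xs" "distinct ys" "length xs = length ys"
  obtains g where "bij_betw g (set xs) (set ys)" "map g xs = ys"
proof -
  define g where "g x = the (map_of (zip xs ys) x)" for x
  have nth: "g (xs ! i) = ys ! i" if "i < length xs" for i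
    using that assms by (simp add: g_def map_of_zip_nth)
  then have m: "map g xs = ys" using assms(3) by (auto intro: nth_equalityI)
  moreover have "inj_on g (set xs)" using m assms(1,2) distinct_map by metis
  ultimately show thesis using that[of g] by (metis bij_betw_def list.set_map)
qed

lemma concat_eq_concat_iff_map_length:
  "concat xss = concat yss \<Longrightarrow> map length xss = map length yss \<Longrightarrow> xss = yss"
proof (induction xss arbitrary: yss)
  case (Cons xs xss)
  then show ?case by (cases yss) auto
qed simp

text \<open>Cycles of equal length are lined up and written one after another; \<open>g\<close>
  matches the two resulting enumerations entry by entry. As the lengths agree, it carries each cycle
  to its partner. The ground sets may differ, because this serves both to conjugate inside
  \<open>A\<close> and to carry a constructed product onto a given permutation.\<close>

lemma cycle_type_dec_bij:
  assumes p: "cycle_type_dec p X V" and q: "cycle_type_dec q Y W"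
    and len: "image_mset length V = image_mset length W"
  obtains g where "bij_betw g X Y" "image_mset (map g) V = W"
    "\<And>x. x \<in> X \<Longrightarrow> q (g x) = g (p x)"
proof -
  obtain vs where vs: "mset vs = V" using ex_mset by blast
  obtain ws where ws: "mset ws = W" "map length vs = map length ws"
    using list_of_image_mset_eq[of length vs length W] len vs by metis
  have mv: "mset (concat vs) = mset_set X" using p vs by (simp add: cycle_type_dec_def mset_concat_sum)
  have mw: "mset (concat ws) = mset_set Y" using q ws by (simp add: cycle_type_dec_def mset_concat_sum)
  have fin: "finite X" "finite Y" using p q by (auto simp: cycle_type_dec_def)
  have dist: "set xs = Z \<and> distinct xs" if m: "mset xs = mset_set Z" and f: "finite Z" for xs :: "'c list" and Z
  proof -
    obtain ys where "set ys = Z" "distinct ys" using finite_distinct_list[OF f] by blast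
    moreover from this have "mset xs = mset ys" using m mset_set_set by metis
    ultimately show ?thesis using mset_eq_setD mset_eq_imp_distinct_iff by metis
  qed
  note X = dist[OF mv fin(1)] and Y = dist[OF mw fin(2)]
  have "length (concat vs) = length (concat ws)" using ws(2) by (simp add: length_concat)
  then obtain g where g: "bij_betw g X Y" "map g (concat vs) = concat ws"
    using bij_of_distinct_lists[of "concat vs" "concat ws"] X Y by metis
  have "concat (map (map g) vs) = concat ws" using g(2) by (simp add: map_concat)
  moreover have "map length (map (map g) vs) = map length ws" using ws(2) by (simp add: comp_def)
  ultimately have m: "map (map g) vs = ws"
    by (metis length_map concat_eq_concat_iff_map_length)
  have "q (g x) = g (p x)" if x: "x \<in> X" for x
  proof -
    obtain v where v: "v \<in># V" "x \<in> set v" using cycle_type_dec_cover[OF p x] .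
    have "map g v \<in># W" using v(1) m vs ws(1) by auto
    then show ?thesis using cyc_map[of p v q g x] p q v by (auto simp: cycle_type_dec_def)
  qed
  moreover have "image_mset (map g) V = W" using m vs ws(1) by (metis mset_map)
  ultimately show thesis using that g(1) by blast
qed

section \<open>Growing a factorization point by point\<close>

type_synonym word = "(nat \<times> nat) list"

definition letters :: "word multiset \<Rightarrow> (nat \<times> nat) multiset" where
  "letters S = (\<Sum>w\<in>#S. mset w)"

lemma letters_simps [simp]:
  "letters {#} = {#}" "letters (add_mset w S) = mset w + letters S" "letters (S + T) = letters S + letters T"
  by (simp_all add: letters_def)

text \<open>A multiset of words records the cycles of a product \<open>s \<circ> s'\<close>: a point is a letter \<open>(i, j)\<close> if it lies in
  the \<open>i\<close>-th cycle of \<open>s\<close> and the \<open>j\<close>-th cycle of \<open>s'\<close>, and words are read cyclically. The rules \<open>merge\<close> and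
  \<open>split\<close> are the effect on the product of inserting a new point just before \<open>hd U\<close> or
  \<open>hd F\<close> in its cycle of \<open>s\<close> and just after \<open>last V\<close> or \<open>last F\<close> in its cycle of \<open>s'\<close>. Rule \<open>fixed\<close> inserts a point after \<open>x\<close> in \<open>s\<close> and
  before \<open>x\<close> in \<open>s'\<close> for a point \<open>x\<close> labelled \<open>(i, i)\<close>, so that the two insertions cancel in the product.\<close>

inductive reach :: "word multiset \<Rightarrow> bool" where
  empty: "reach {#}"
| rot: "reach (add_mset (F @ G) S) \<Longrightarrow> reach (add_mset (G @ F) S)"
| new: "reach S \<Longrightarrow> \<forall>l\<in>#letters S. fst l \<noteq> i \<and> snd l \<noteq> i \<Longrightarrow> reach (add_mset [(i, i)] S)"
| fixed: "reach S \<Longrightarrow> (i, i) \<in># letters S \<Longrightarrow> reach (add_mset [(i, i)] S)"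
| new_row: "reach (add_mset V S) \<Longrightarrow> \<forall>l\<in>#letters (add_mset V S). fst l \<noteq> i \<Longrightarrow> V \<noteq> [] \<Longrightarrow> snd (last V) = j \<Longrightarrow>
    reach (add_mset (V @ [(i, j)]) S)"
| new_col: "reach (add_mset U S) \<Longrightarrow> \<forall>l\<in>#letters (add_mset U S). snd l \<noteq> j \<Longrightarrow> U \<noteq> [] \<Longrightarrow> fst (hd U) = i \<Longrightarrow>
    reach (add_mset (U @ [(i, j)]) S)"
| merge: "reach (add_mset U (add_mset V S)) \<Longrightarrow> U \<noteq> [] \<Longrightarrow> V \<noteq> [] \<Longrightarrow> fst (hd U) = i \<Longrightarrow> snd (last V) = j \<Longrightarrow>
    reach (add_mset (U @ [(i, j)] @ V) S)"
| split: "reach (add_mset (F @ G) S) \<Longrightarrow> F \<noteq> [] \<Longrightarrow> fst (hd F) = i \<Longrightarrow> snd (last F) = j \<Longrightarrow>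
    reach (add_mset F (add_mset (G @ [(i, j)]) S))"

text \<open>\<open>r\<close> numbers the cycles of \<open>s\<close>: its fibres are the orbits.\<close>

definition bins :: "('a \<Rightarrow> 'a) \<Rightarrow> 'a set \<Rightarrow> ('a \<Rightarrow> nat) \<Rightarrow> bool" where
  "bins s X r \<longleftrightarrow> s permutes X \<and> (\<forall>x\<in>X. \<exists>xs. cyc s xs \<and> set xs = {y\<in>X. r y = r x})"

lemma bins_permutes: "bins s X r \<Longrightarrow> s permutes X"
  by (simp add: bins_def)

lemma bins_insert_before:
  assumes b: "bins s X r" and z: "z \<notin> X" and v: "v \<in> X"
  shows "bins (transpose z v \<circ> s) (insert z X) (r(z := r v))"
  unfolding bins_def
proof (intro conjI ballI)
  have s: "s permutes X" using b by (simp add: bins_def)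
  then have sz: "s z = z" using z by (auto simp: permutes_not_in)
  show "transpose z v \<circ> s permutes insert z X"
    using v s permutes_subset[of s X "insert z X"] by (intro permutes_compose permutes_swap_id) auto
  fix x assume x: "x \<in> insert z X"
  define x' where "x' = (if x = z then v else x)"
  have x': "x' \<in> X" "(r(z := r v)) x = r x'" using x v by (auto simp: x'_def)
  obtain xs where xs: "cyc s xs" "set xs = {y\<in>X. r y = r x'}"
    using b x'(1) unfolding bins_def by blast
  have zxs: "z \<notin> set xs" using xs(2) z by auto
  show "\<exists>xs. cyc (transpose z v \<circ> s) xs \<and> set xs = {y \<in> insert z X. (r(z := r v)) y = (r(z := r v)) x}"
  proof (cases "r x' = r v")
    case True
    then obtain ys where ys: "cyc (transpose z v \<circ> s) ys" "mset ys = add_mset z (mset xs)"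
      using cyc_insert_before[OF xs(1) _ zxs sz, of v] xs(2) v by auto
    have "set ys = insert z (set xs)" using mset_eq_setD[of ys "z # xs"] ys(2) by simp
    also have "\<dots> = {y \<in> insert z X. (r(z := r v)) y = (r(z := r v)) x}"
      using xs(2) x'(2) True z by auto
    finally show ?thesis using ys(1) by blast
  next
    case False
    then have "v \<notin> set xs" using xs(2) by auto
    from cyc_transpose_outside[OF xs(1) this zxs] show ?thesis
      using xs(2) x'(2) False z by (intro exI[of _ xs]) auto
  qed
qed

lemma bins_image:
  assumes "bins s X r" "x \<in> X"
  shows "s x \<in> X" "r (s x) = r x"
proof -
  obtain xs where xs: "cyc s xs" "set xs = {y\<in>X. r y = r x}"
    using assms unfolding bins_def by blast
  then have "s x \<in> set xs" using cyc_image[of s xs x] assms(2) by auto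
  then show "s x \<in> X" "r (s x) = r x" using xs(2) by auto
qed

lemma bins_insert_after:
  assumes b: "bins s X r" and z: "z \<notin> X" and w: "w \<in> X"
  shows "bins (s \<circ> transpose w z) (insert z X) (r(z := r w))"
proof -
  have s: "s permutes X" using b by (simp add: bins_def)
  then have sz: "s z = z" using z by (auto simp: permutes_not_in)
  have "inj s" using s by (rule permutes_inj)
  then have inj: "s x = s y \<longleftrightarrow> x = y" "s x = z \<longleftrightarrow> x = z" for x y
    using sz by (metis injD)+
  \<comment> \<open>Inserting after \<open>w\<close> is inserting before \<open>s w\<close>.\<close>
  have "s \<circ> transpose w z = transpose z (s w) \<circ> s"
    by (rule ext) (simp add: transpose_def inj sz)
  then show ?thesis using bins_insert_before[OF b z, of "s w"] bins_image[OF b w] by simp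
qed

lemma bins_insert_new:
  assumes b: "bins s X r" and z: "z \<notin> X" and i: "\<forall>x\<in>X. r x \<noteq> i"
  shows "bins s (insert z X) (r(z := i))"
  unfolding bins_def
proof (intro conjI ballI)
  have s: "s permutes X" using b by (simp add: bins_def)
  then show "s permutes insert z X" using permutes_subset[of s X] by auto
  have sz: "s z = z" using z s by (auto simp: permutes_not_in)
  fix x assume x: "x \<in> insert z X"
  show "\<exists>xs. cyc s xs \<and> set xs = {y \<in> insert z X. (r(z := i)) y = (r(z := i)) x}"
  proof (cases "x = z")
    case True
    then show ?thesis using sz i by (intro exI[of _ "[z]"]) (auto simp: cyc_def)
  next
    case False
    then obtain xs where "cyc s xs" "set xs = {y\<in>X. r y = r x}"
      using b x unfolding bins_def by blast
    then show ?thesis using False x i z by (intro exI[of _ xs]) auto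
  qed
qed

section \<open>Insertion of a point and the cycles of the product\<close>

definition realizes :: "nat set \<Rightarrow> (nat \<Rightarrow> nat) \<Rightarrow> (nat \<Rightarrow> nat) \<Rightarrow> (nat \<Rightarrow> nat) \<Rightarrow> (nat \<Rightarrow> nat) \<Rightarrow>
    nat list multiset \<Rightarrow> bool" where
  "realizes X s s' r c W \<longleftrightarrow> bins s X r \<and> bins s' X c \<and> cycle_type_dec (s \<circ> s') X W"

definition label :: "(nat \<Rightarrow> nat) \<Rightarrow> (nat \<Rightarrow> nat) \<Rightarrow> nat list \<Rightarrow> word" where
  "label r c = map (\<lambda>x. (r x, c x))"

lemma label_upd:
  "z \<notin> set w \<Longrightarrow> label (r(z := i)) (c(z := j)) w = label r c w"
  by (auto simp: label_def)

lemma label_image_upd: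
  assumes "cycle_type_dec p X W" "z \<notin> X"
  shows "image_mset (label (r(z := i)) (c(z := j))) W = image_mset (label r c) W"
  by (rule image_mset_cong, rule label_upd) (use assms cycle_type_dec_set in blast)

lemma letters_label:
  assumes "cycle_type_dec p X W"
  shows "set_mset (letters (image_mset (label r c) W)) = (\<lambda>x. (r x, c x)) ` X"
proof -
  have "letters (image_mset (label r c) W) = image_mset (\<lambda>x. (r x, c x)) (\<Sum>w\<in>#W. mset w)"
    by (induction W) (auto simp: label_def)
  then show ?thesis using assms by (simp add: cycle_type_dec_def)
qed

text \<open>\<open>t'\<close> is what the product \<open>t\<close> becomes when \<open>z\<close>
  enters the first factor before \<open>v\<close> and the second factor after \<open>w\<close>. Now
  \<open>w\<close> goes to \<open>v\<close>, and \<open>z\<close> takes over the old image of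
  \<open>w\<close> and the old preimage of \<open>v\<close>; if these were the same arrow,
  \<open>z\<close> is fixed.\<close>

lemma conj_transposes_apply:
  assumes "t permutes X" "z \<notin> X" "v \<in> X" "w \<in> X"
  defines "t' \<equiv> transpose z v \<circ> t \<circ> transpose w z"
  shows "t' w = v" "t' z = (if t w = v then z else t w)"
    "\<And>e. e \<in> X \<Longrightarrow> e \<noteq> w \<Longrightarrow> t' e = (if t e = v then z else t e)"
proof -
  have im: "t e \<in> X" if "e \<in> X" for e using assms(1) that by (simp add: permutes_in_image)
  have tz: "t z = z" using assms(1,2) by (auto simp: permutes_not_in)
  show "t' w = v" using tz by (simp add: t'_def)
  show "t' z = (if t w = v then z else t w)" using im[OF assms(4)] assms(2) by (auto simp: t'_def transpose_def)
  show "t' e = (if t e = v then z else t e)" if "e \<in> X" "e \<noteq> w" for e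
    using im[OF that(1)] assms(2) that by (auto simp: t'_def transpose_def)
qed

lemma cyc_other:
  assumes "cyc t xs" "\<And>e. e \<in> set xs \<Longrightarrow> t' e = t e"
  shows "cyc t' xs"
proof -
  have "successively (\<lambda>a b. t' a = b) xs"
    by (rule successively_weaken[where P = "\<lambda>a b. t a = b"])
      (use assms in \<open>auto simp: cyc_def dest: in_set_butlastD\<close>)
  then show ?thesis using assms by (simp add: cyc_def)
qed

lemma distinct_butlast_last: "distinct xs \<Longrightarrow> a \<in> set (butlast xs) \<Longrightarrow> a \<noteq> last xs"
  by (induction xs) (auto split: if_splits)

lemma distinct_tl_hd: "distinct xs \<Longrightarrow> b \<in> set (tl xs) \<Longrightarrow> b \<noteq> hd xs"
  by (cases xs) auto

text \<open>Instead of closing up, \<open>U\<close> continues from its last entry to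
  \<open>z\<close> and on to \<open>hd V\<close>; then \<open>last V\<close> returns to
  \<open>hd U\<close>.\<close>

lemma cyc_conj_merge:
  assumes t: "t permutes X" and z: "z \<notin> X" and UV: "set U \<subseteq> X" "set V \<subseteq> X" "set U \<inter> set V = {}"
    and U: "cyc t U" and V: "cyc t V"
  defines "t' \<equiv> transpose z (hd U) \<circ> t \<circ> transpose (last V) z"
  shows "cyc t' (U @ [z] @ V)"
proof -
  have ne: "U \<noteq> []" "V \<noteq> []" using U V by (auto simp: cyc_def)
  have mem: "hd U \<in> X" "last V \<in> X" "hd U \<in> set U" "last U \<in> set U" "last V \<in> set V" "hd V \<in> set V"
    using ne UV by auto
  note ap = conj_transposes_apply[OF t z mem(1,2), folded t'_def]
  have dU: "distinct U" "distinct V" using U V by (auto simp: cyc_def)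
  have "successively (\<lambda>a b. t' a = b) U"
  proof (rule successively_weaken[where P = "\<lambda>a b. t a = b"])
    show "successively (\<lambda>a b. t a = b) U" using U by (simp add: cyc_def)
    fix a b assume ab: "a \<in> set (butlast U)" "b \<in> set (tl U)" "t a = b"
    have "a \<in> set U" using ab(1) by (rule in_set_butlastD)
    moreover have "b \<noteq> hd U" using ab(2) dU(1) ne(1) by (cases U) auto
    moreover have "a \<noteq> last V" using calculation(1) UV(3) mem(5) by auto
    ultimately show "t' a = b" using ap(3)[of a] ab(3) UV(1) by auto
  qed
  moreover have "successively (\<lambda>a b. t' a = b) V"
  proof (rule successively_weaken[where P = "\<lambda>a b. t a = b"])
    show "successively (\<lambda>a b. t a = b) V" using V by (simp add: cyc_def)
    fix a b assume ab: "a \<in> set (butlast V)" "b \<in> set (tl V)" "t a = b"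
    have aV: "a \<in> set V" using ab(1) by (rule in_set_butlastD)
    have "a \<noteq> last V" using distinct_butlast_last dU(2) ab(1) by metis
    moreover have "b \<in> set V" using ab(2) ne(2) by (cases V) auto
    then have "b \<noteq> hd U" using UV(3) mem(3) by auto
    ultimately show "t' a = b" using ap(3)[of a] aV ab(3) UV(2) by auto
  qed
  moreover have "last U \<noteq> last V" "hd V \<noteq> hd U" using UV(3) mem by auto
  moreover have "t (last U) = hd U" "t (last V) = hd V" using U V by (simp_all add: cyc_def)
  moreover have "t' (last U) = z" using ap(3)[of "last U"] calculation mem(4) UV(1) by auto
  moreover have "t' z = hd V" using ap(2) calculation by auto
  moreover have "z \<notin> set U" "z \<notin> set V" using z UV by auto
  ultimately show ?thesis using ap(1) dU UV(3) ne
    by (simp add: cyc_def successively_append_iff successively_Cons)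
qed

text \<open>Here the two chosen points are the ends of \<open>F\<close>, so \<open>F\<close> closes
  up by itself, and \<open>z\<close> fills the gap left between \<open>last G\<close> and
  \<open>hd G\<close>. If \<open>G\<close> is empty, \<open>z\<close> becomes a fixed point.\<close>

lemma cyc_conj_split:
  assumes t: "t permutes X" and z: "z \<notin> X" and FG: "set (F @ G) \<subseteq> X" "F \<noteq> []"
    and c: "cyc t (F @ G)"
  defines "t' \<equiv> transpose z (hd F) \<circ> t \<circ> transpose (last F) z"
  shows "cyc t' F" "cyc t' (G @ [z])"
proof -
  have mem: "hd F \<in> X" "last F \<in> X" "hd F \<in> set F" "last F \<in> set F" using FG by auto
  note ap = conj_transposes_apply[OF t z mem(1,2), folded t'_def]
  have d: "distinct F" "distinct G" "set F \<inter> set G = {}" using c by (auto simp: cyc_def)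
  have sF: "successively (\<lambda>a b. t a = b) F" and sG: "successively (\<lambda>a b. t a = b) G"
    using c by (auto simp: cyc_def successively_append_iff)
  have "successively (\<lambda>a b. t' a = b) F"
  proof (rule successively_weaken[OF sF])
    fix a b assume ab: "a \<in> set (butlast F)" "b \<in> set (tl F)" "t a = b"
    have "a \<in> set F" using ab(1) by (rule in_set_butlastD)
    moreover have "b \<noteq> hd F" using ab(2) d(1) FG(2) by (cases F) auto
    moreover have "a \<noteq> last F" using ab(1) d(1) FG(2)
      using distinct_butlast_last by metis
    ultimately show "t' a = b" using ap(3)[of a] ab(3) FG(1) by auto
  qed
  then show "cyc t' F" using ap(1) d FG(2) by (auto simp: cyc_def)
  show "cyc t' (G @ [z])"
  proof (cases "G = []")
    case True
    then show ?thesis using ap(2) c by (auto simp: cyc_def)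
  next
    case False
    have "successively (\<lambda>a b. t' a = b) G"
    proof (rule successively_weaken[OF sG])
      fix a b assume ab: "a \<in> set (butlast G)" "b \<in> set (tl G)" "t a = b"
      have aG: "a \<in> set G" using ab(1) by (rule in_set_butlastD)
      have "b \<in> set G" using ab(2) False by (cases G) auto
      then have "b \<noteq> hd F" "a \<noteq> last F" using aG d(3) mem(3,4) by auto
      then show "t' a = b" using ap(3)[of a] ab(3) aG FG(1) by auto
    qed
    moreover have G: "last G \<in> set G" "hd G \<in> set G" using False by auto
    have tG: "t (last F) = hd G" "t (last G) = hd F"
      using c False FG(2) by (auto simp: cyc_def successively_append_iff)
    have "hd G \<noteq> hd F" "last G \<noteq> last F" using G d(3) mem(3,4) by auto
    then have "t' z = hd G" "t' (last G) = z"
      using ap(2) ap(3)[of "last G"] tG G(1) FG(1) by auto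
    moreover have "z \<notin> set G" using z FG(1) by auto
    ultimately show ?thesis using d(2) False
      by (simp add: cyc_def successively_append_iff)
  qed
qed


lemma cyc_conj_other:
  assumes t: "t permutes X" "z \<notin> X" "v \<in> X" "w \<in> X" and e: "cyc t e" "set e \<subseteq> X" "v \<notin> set e" "w \<notin> set e"
  shows "cyc (transpose z v \<circ> t \<circ> transpose w z) e"
proof (rule cyc_other[OF e(1)])
  fix x assume x: "x \<in> set e"
  then have "t x \<noteq> v" "x \<noteq> w" "x \<in> X" using cyc_image[OF e(1) x] e by auto
  then show "(transpose z v \<circ> t \<circ> transpose w z) x = t x"
    using conj_transposes_apply(3)[OF t, of x] by simp
qed

lemma realizes_insert:
  assumes R: "realizes X s s' r c W" and z: "z \<notin> X" and v: "v \<in> X" and w: "w \<in> X"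
    and cyc: "\<And>e. e \<in># W' \<Longrightarrow> cyc (transpose z v \<circ> (s \<circ> s') \<circ> transpose w z) e"
    and sum: "(\<Sum>e\<in>#W'. mset e) = add_mset z (\<Sum>e\<in>#W. mset e)"
  shows "realizes (insert z X) (transpose z v \<circ> s) (s' \<circ> transpose w z) (r(z := r v)) (c(z := c w)) W'"
proof -
  have b: "bins (transpose z v \<circ> s) (insert z X) (r(z := r v))"
      "bins (s' \<circ> transpose w z) (insert z X) (c(z := c w))"
    using R bins_insert_before[OF _ z v] bins_insert_after[OF _ z w] by (auto simp: realizes_def)
  have eq: "(transpose z v \<circ> s) \<circ> (s' \<circ> transpose w z) = transpose z v \<circ> (s \<circ> s') \<circ> transpose w z"
    by (simp add: o_assoc)
  have "(transpose z v \<circ> s) \<circ> (s' \<circ> transpose w z) permutes insert z X"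
    by (rule permutes_compose[OF bins_permutes[OF b(2)] bins_permutes[OF b(1)]])
  then show ?thesis using b cyc sum R z unfolding realizes_def cycle_type_dec_def eq by simp
qed

lemma label_append: "label r c (u @ v) = label r c u @ label r c v"
  and label_Nil: "label r c [] = []"
  and label_Cons: "label r c (x # u) = (r x, c x) # label r c u"
  by (simp_all add: label_def)

text \<open>Each rule is carried out on actual permutations, with a fresh natural number
  \<open>z\<close> as the new point; updating \<open>r\<close> and \<open>c\<close> at
  \<open>z\<close> leaves the labels of all old points alone. The ground set is some finite set of
  naturals, to be renamed at the end.\<close>

theorem reach_realizes:
  "reach S \<Longrightarrow> \<exists>X s s' r c W. realizes X s s' r c W \<and> image_mset (label r c) W = S"
proof (induction rule: reach.induct)
  case empty
  have "realizes {} id id (\<lambda>_. 0) (\<lambda>_. 0) {#}"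
    by (auto simp: realizes_def bins_def cycle_type_dec_def permutes_id)
  then show ?case by fastforce
next
  case (rot F G S)
  then obtain X s s' r c W where R: "realizes X s s' r c W" "image_mset (label r c) W = add_mset (F @ G) S"
    by blast
  obtain w W' where W: "W = add_mset w W'" "label r c w = F @ G" "image_mset (label r c) W' = S"
    using msed_map_invR[OF R(2)] by metis
  obtain f g where w: "w = f @ g" "label r c f = F" "label r c g = G"
    using W(2) unfolding label_def by (auto simp: map_eq_append_conv)
  have "realizes X s s' r c (add_mset (g @ f) W')"
    using R(1) cyc_rotate[of "s \<circ> s'" f g] unfolding W(1) w(1) realizes_def cycle_type_dec_def
    by (simp add: add.commute)
  moreover have "image_mset (label r c) (add_mset (g @ f) W') = add_mset (G @ F) S"
    using W w by (simp add: label_def)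
  ultimately show ?case by blast
next
  case (new S i)
  then obtain X s s' r c W where R: "realizes X s s' r c W" "image_mset (label r c) W = S"
    by blast
  have bs: "bins s X r" and bc: "bins s' X c" and d: "cycle_type_dec (s \<circ> s') X W"
    using R(1) by (simp_all add: realizes_def)
  obtain z where z: "z \<notin> X" using d ex_new_if_finite[OF infinite_UNIV_nat] by (metis cycle_type_dec_def)
  have "set_mset (letters S) = (\<lambda>x. (r x, c x)) ` X" using letters_label[OF d, of r c] R(2) by simp
  then have i: "\<forall>x\<in>X. r x \<noteq> i" "\<forall>x\<in>X. c x \<noteq> i" using new.hyps(2) by auto
  have "realizes (insert z X) s s' (r(z := i)) (c(z := i)) (add_mset [z] W)"
    unfolding realizes_def
    using bins_insert_new[OF bs z i(1)] bins_insert_new[OF bc z i(2)] cycle_type_dec_insert_fixed[OF d z]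
    by blast
  moreover have "image_mset (label (r(z := i)) (c(z := i))) (add_mset [z] W) = add_mset [(i, i)] S"
    using label_image_upd[OF d z, of r i c i] R(2) by (simp add: label_Cons label_Nil)
  ultimately show ?case by blast
next
  case (fixed S i)
  then obtain X s s' r c W where R: "realizes X s s' r c W" "image_mset (label r c) W = S"
    by blast
  have bs: "bins s X r" and bc: "bins s' X c" and d: "cycle_type_dec (s \<circ> s') X W"
    using R(1) by (simp_all add: realizes_def)
  obtain z where z: "z \<notin> X" using d ex_new_if_finite[OF infinite_UNIV_nat] by (metis cycle_type_dec_def)
  have "set_mset (letters S) = (\<lambda>x. (r x, c x)) ` X" using letters_label[OF d, of r c] R(2) by simp
  then obtain x where x: "x \<in> X" "r x = i" "c x = i" using fixed.hyps(2) by auto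
  have "(s \<circ> transpose x z) \<circ> (transpose z x \<circ> s') = s \<circ> s'"
    by (simp add: fun_eq_iff transpose_commute)
  then have "realizes (insert z X) (s \<circ> transpose x z) (transpose z x \<circ> s') (r(z := i)) (c(z := i)) (add_mset [z] W)"
    unfolding realizes_def
    using bins_insert_after[OF bs z x(1)] bins_insert_before[OF bc z x(1)]
      cycle_type_dec_insert_fixed[OF d z] x(2,3)
    by simp
  moreover have "image_mset (label (r(z := i)) (c(z := i))) (add_mset [z] W) = add_mset [(i, i)] S"
    using label_image_upd[OF d z, of r i c i] R(2) by (simp add: label_Cons label_Nil)
  ultimately show ?case by blast
next
  case (new_row V S i j)
  then obtain X s s' r c W where R: "realizes X s s' r c W" "image_mset (label r c) W = add_mset V S"
    by blast
  have bs: "bins s X r" and bc: "bins s' X c" and d: "cycle_type_dec (s \<circ> s') X W"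
    using R(1) by (simp_all add: realizes_def)
  obtain z where z: "z \<notin> X" using d ex_new_if_finite[OF infinite_UNIV_nat] by (metis cycle_type_dec_def)
  have "set_mset (letters (add_mset V S)) = (\<lambda>x. (r x, c x)) ` X" using letters_label[OF d, of r c] R(2) by simp
  then have i: "\<forall>x\<in>X. r x \<noteq> i" using new_row.hyps(2) by auto
  obtain v W' where W: "W = add_mset v W'" "label r c v = V" "image_mset (label r c) W' = S"
    using msed_map_invR[OF R(2)] by metis
  have v: "v \<noteq> []" "cyc (s \<circ> s') v" "set v \<subseteq> X"
    using W new_row.hyps(3) d cycle_type_dec_set[OF d, of v] by (auto simp: label_def cycle_type_dec_def)
  define w where "w = last v"
  have w: "w \<in> X" "c w = j" "w \<in> set v"
    using v new_row.hyps(4) W(2) by (auto simp: w_def label_def last_map)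
  have p: "s permutes X" "s' permutes X" using R(1) by (auto simp: realizes_def bins_def)
  have sz: "(s \<circ> s') z = z" using p z by (auto simp: permutes_not_in)
  have tw: "(s \<circ> s') w = hd v" using v by (simp add: cyc_def w_def)
  \<comment> \<open>\<open>z\<close> forms a cycle of its own in \<open>s\<close>, so only its
    insertion into \<open>s'\<close> acts on the product.\<close>
  let ?t = "(s \<circ> s') \<circ> transpose w z"
  have zv: "z \<notin> set v" using v z by auto
  have "successively (\<lambda>a b. ?t a = b) v"
  proof (rule successively_weaken[where P = "\<lambda>a b. (s \<circ> s') a = b"])
    show "successively (\<lambda>a b. (s \<circ> s') a = b) v" using v by (simp add: cyc_def)
    fix a b assume a: "a \<in> set (butlast v)" "(s \<circ> s') a = b"
    have "a \<noteq> w" using a(1) v(2) distinct_butlast_last unfolding w_def cyc_def by metis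
    moreover have "a \<noteq> z" using in_set_butlastD[OF a(1)] zv by auto
    ultimately show "?t a = b" using a(2) by (simp add: transpose_def)
  qed
  moreover have "?t w = z" "?t z = hd v" using sz tw by (simp_all add: comp_def)
  ultimately have cv: "cyc ?t (v @ [z])" using v zv
    by (simp add: cyc_def successively_append_iff w_def)
  have ce: "cyc ?t e" if e: "e \<in># W'" for e
  proof (rule cyc_other)
    show "cyc (s \<circ> s') e" using e d W(1) by (simp add: cycle_type_dec_def)
    fix x assume "x \<in> set e"
    then have "x \<noteq> w" "x \<noteq> z"
      using cycle_type_dec_disjoint[of _ X v W' e] cycle_type_dec_set[OF d, of e] d W(1) e w(3) z by auto
    then show "?t x = (s \<circ> s') x" by (simp add: transpose_def)
  qed
  have b: "bins s (insert z X) (r(z := i))" "bins (s' \<circ> transpose w z) (insert z X) (c(z := j))"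
    using bins_insert_new[OF bs z i] bins_insert_after[OF bc z w(1)] w(2) by simp_all
  have "s \<circ> (s' \<circ> transpose w z) permutes insert z X"
    by (rule permutes_compose[OF bins_permutes[OF b(2)] bins_permutes[OF b(1)]])
  then have "realizes (insert z X) s (s' \<circ> transpose w z) (r(z := i)) (c(z := j)) (add_mset (v @ [z]) W')"
    using b cv ce d z unfolding W(1) realizes_def cycle_type_dec_def o_assoc by simp
  moreover have "image_mset (label (r(z := i)) (c(z := j))) (add_mset (v @ [z]) W') = add_mset (V @ [(i, j)]) S"
    using label_image_upd[OF d z, of r i c j] W label_upd[OF zv, of r i c j]
    by (simp add: label_append label_Cons label_Nil)
  ultimately show ?case by blast
next
  case (new_col U S j i)
  then obtain X s s' r c W where R: "realizes X s s' r c W" "image_mset (label r c) W = add_mset U S"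
    by blast
  have bs: "bins s X r" and bc: "bins s' X c" and d: "cycle_type_dec (s \<circ> s') X W"
    using R(1) by (simp_all add: realizes_def)
  obtain z where z: "z \<notin> X" using d ex_new_if_finite[OF infinite_UNIV_nat] by (metis cycle_type_dec_def)
  have "set_mset (letters (add_mset U S)) = (\<lambda>x. (r x, c x)) ` X" using letters_label[OF d, of r c] R(2) by simp
  then have j: "\<forall>x\<in>X. c x \<noteq> j" using new_col.hyps(2) by auto
  obtain u W' where W: "W = add_mset u W'" "label r c u = U" "image_mset (label r c) W' = S"
    using msed_map_invR[OF R(2)] by metis
  have u: "u \<noteq> []" "cyc (s \<circ> s') u" "set u \<subseteq> X"
    using W new_col.hyps(3) d cycle_type_dec_set[OF d, of u] by (auto simp: label_def cycle_type_dec_def)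
  define v where "v = hd u"
  have v: "v \<in> X" "r v = i" "v \<in> set u"
    using u new_col.hyps(4) W(2) by (auto simp: v_def label_def hd_map)
  have p: "s permutes X" "s' permutes X" using R(1) by (auto simp: realizes_def bins_def)
  have sz: "(s \<circ> s') z = z" using p z by (auto simp: permutes_not_in)
  \<comment> \<open>Now \<open>z\<close> is alone in its cycle of \<open>s'\<close>, and only its
    insertion into \<open>s\<close> acts on the product.\<close>
  let ?t = "transpose z v \<circ> (s \<circ> s')"
  have zu: "z \<notin> set u" using u z by auto
  have "successively (\<lambda>a b. ?t a = b) u"
  proof (rule successively_weaken[where P = "\<lambda>a b. (s \<circ> s') a = b"])
    show "successively (\<lambda>a b. (s \<circ> s') a = b) u" using u by (simp add: cyc_def)
    fix a b assume a: "b \<in> set (tl u)" "(s \<circ> s') a = b"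
    have "b \<noteq> v" using a(1) u(2) distinct_tl_hd unfolding v_def cyc_def by metis
    moreover have "b \<noteq> z" using a(1) zu u(1) by (cases u) auto
    ultimately show "?t a = b" using a(2) by (simp add: transpose_def)
  qed
  moreover have "?t (last u) = z" "?t z = v" using sz u by (simp_all add: cyc_def v_def)
  ultimately have cv: "cyc ?t (u @ [z])" using u zu
    by (simp add: cyc_def successively_append_iff v_def)
  have ce: "cyc ?t e" if e: "e \<in># W'" for e
  proof (rule cyc_transpose_outside)
    show "cyc (s \<circ> s') e" using e d W(1) by (simp add: cycle_type_dec_def)
    show "v \<notin> set e" using cycle_type_dec_disjoint[of _ X u W' e] d W(1) e v(3) by auto
    show "z \<notin> set e" using cycle_type_dec_set[OF d, of e] W(1) e z by auto
  qed
  have b: "bins (transpose z v \<circ> s) (insert z X) (r(z := i))" "bins s' (insert z X) (c(z := j))"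
    using bins_insert_new[OF bc z j] bins_insert_before[OF bs z v(1)] v(2) by simp_all
  have "(transpose z v \<circ> s) \<circ> s' permutes insert z X"
    by (rule permutes_compose[OF bins_permutes[OF b(2)] bins_permutes[OF b(1)]])
  then have "realizes (insert z X) (transpose z v \<circ> s) s' (r(z := i)) (c(z := j)) (add_mset (u @ [z]) W')"
    using b cv ce d z unfolding W(1) realizes_def cycle_type_dec_def o_assoc by simp
  moreover have "image_mset (label (r(z := i)) (c(z := j))) (add_mset (u @ [z]) W') = add_mset (U @ [(i, j)]) S"
    using label_image_upd[OF d z, of r i c j] W label_upd[OF zu, of r i c j]
    by (simp add: label_append label_Cons label_Nil)
  ultimately show ?case by blast
next
  case (merge U V S i j)
  then obtain X s s' r c W where R: "realizes X s s' r c W" "image_mset (label r c) W = add_mset U (add_mset V S)"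
    by blast
  have bs: "bins s X r" and bc: "bins s' X c" and d: "cycle_type_dec (s \<circ> s') X W"
    using R(1) by (simp_all add: realizes_def)
  obtain z where z: "z \<notin> X" using d ex_new_if_finite[OF infinite_UNIV_nat] by (metis cycle_type_dec_def)
  obtain u W0 where W0: "W = add_mset u W0" "label r c u = U" "image_mset (label r c) W0 = add_mset V S"
    using msed_map_invR[OF R(2)] by metis
  obtain v W' where W': "W0 = add_mset v W'" "label r c v = V" "image_mset (label r c) W' = S"
    using msed_map_invR[OF W0(3)] by metis
  note W = W0(1)[unfolded W'(1)]
  have uv: "cyc (s \<circ> s') u" "cyc (s \<circ> s') v" "set u \<subseteq> X" "set v \<subseteq> X" "set u \<inter> set v = {}"
    using d W cycle_type_dec_set[OF d, of u] cycle_type_dec_set[OF d, of v]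
      cycle_type_dec_disjoint[of _ X u W0 v] W0(1) W'(1) by (auto simp: cycle_type_dec_def)
  then have ne: "u \<noteq> []" "v \<noteq> []" by (auto simp: cyc_def)
  have zu: "z \<notin> set u" and zv: "z \<notin> set v" using uv z by auto
  have x: "hd u \<in> X" "last v \<in> X" "hd u \<in> set u" "last v \<in> set v" using ne uv by auto
  have lab: "r (hd u) = i" "c (last v) = j"
    using merge.hyps(4,5) W0(2) W'(2) ne by (auto simp: label_def hd_map last_map)
  have p: "s \<circ> s' permutes X" using d by (simp add: cycle_type_dec_def)
  have ce: "cyc (transpose z (hd u) \<circ> (s \<circ> s') \<circ> transpose (last v) z) e" if e: "e \<in># W'" for e
  proof (rule cyc_conj_other[OF p z x(1,2)])
    show "cyc (s \<circ> s') e" "set e \<subseteq> X"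
      using e d W cycle_type_dec_set[OF d, of e] by (auto simp: cycle_type_dec_def)
    have "W = add_mset v (add_mset u W')" using W by (simp add: add_mset_commute)
    then have d': "cycle_type_dec (s \<circ> s') X (add_mset v (add_mset u W'))" using d by metis
    then show "hd u \<notin> set e" "last v \<notin> set e"
      using cycle_type_dec_disjoint[OF d[unfolded W0(1)], of e] cycle_type_dec_disjoint[OF d', of e]
        W'(1) e x by auto
  qed
  have "realizes (insert z X) (transpose z (hd u) \<circ> s) (s' \<circ> transpose (last v) z)
      (r(z := r (hd u))) (c(z := c (last v))) (add_mset (u @ [z] @ v) W')"
    by (rule realizes_insert[OF R(1) z x(1,2)])
      (use ce cyc_conj_merge[OF p z uv(3-5,1,2)] W in auto)
  moreover have "image_mset (label (r(z := i)) (c(z := j))) (add_mset (u @ [z] @ v) W')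
      = add_mset (U @ [(i, j)] @ V) S"
    using label_image_upd[OF d z, of r i c j] W W0 W' label_upd[OF zu, of r i c j] label_upd[OF zv, of r i c j]
    by (simp add: label_append label_Cons label_Nil)
  ultimately show ?case using lab by blast
next
  case (split F G S i j)
  then obtain X s s' r c W where R: "realizes X s s' r c W" "image_mset (label r c) W = add_mset (F @ G) S"
    by blast
  have bs: "bins s X r" and bc: "bins s' X c" and d: "cycle_type_dec (s \<circ> s') X W"
    using R(1) by (simp_all add: realizes_def)
  obtain z where z: "z \<notin> X" using d ex_new_if_finite[OF infinite_UNIV_nat] by (metis cycle_type_dec_def)
  obtain w W' where W: "W = add_mset w W'" "label r c w = F @ G" "image_mset (label r c) W' = S"
    using msed_map_invR[OF R(2)] by metis
  obtain f g where w: "w = f @ g" "label r c f = F" "label r c g = G"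
    using W(2) unfolding label_def by (auto simp: map_eq_append_conv)
  have fg: "cyc (s \<circ> s') (f @ g)" "set (f @ g) \<subseteq> X" "f \<noteq> []"
    using d W(1) w split.hyps(2) cycle_type_dec_set[OF d, of w] by (auto simp: cycle_type_dec_def label_def)
  have zf: "z \<notin> set f" and zg: "z \<notin> set g" using fg(2) z by auto
  have x: "hd f \<in> X" "last f \<in> X" "hd f \<in> set w" "last f \<in> set w" using fg w by auto
  have lab: "r (hd f) = i" "c (last f) = j"
    using split.hyps(3,4) w(2) fg(3) by (auto simp: label_def hd_map last_map)
  have p: "s \<circ> s' permutes X" using d by (simp add: cycle_type_dec_def)
  have ce: "cyc (transpose z (hd f) \<circ> (s \<circ> s') \<circ> transpose (last f) z) e" if e: "e \<in># W'" for e
  proof (rule cyc_conj_other[OF p z x(1,2)])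
    show "cyc (s \<circ> s') e" "set e \<subseteq> X"
      using e d W cycle_type_dec_set[OF d, of e] by (auto simp: cycle_type_dec_def)
    show "hd f \<notin> set e" "last f \<notin> set e"
      using cycle_type_dec_disjoint[of _ X w W' e] d W(1) e x by auto
  qed
  have "realizes (insert z X) (transpose z (hd f) \<circ> s) (s' \<circ> transpose (last f) z)
      (r(z := r (hd f))) (c(z := c (last f))) (add_mset f (add_mset (g @ [z]) W'))"
    by (rule realizes_insert[OF R(1) z x(1,2)])
      (use ce cyc_conj_split[OF p z fg(2,3,1)] W w in auto)
  moreover have "image_mset (label (r(z := i)) (c(z := j))) (add_mset f (add_mset (g @ [z]) W'))
      = add_mset F (add_mset (G @ [(i, j)]) S)"
    using label_image_upd[OF d z, of r i c j] label_upd[OF zf, of r i c j] label_upd[OF zg, of r i c j]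
      W w by (simp add: label_append label_Cons label_Nil)
  ultimately show ?case using lab by blast
qed

section \<open>Filling bins with cycles of the product\<close>

text \<open>What is excluded is a bin that is in use but has no point common to its cycles in both
  factors: then neither \<open>fixed\<close> nor \<open>new\<close> applies.\<close>

definition available :: "nat \<Rightarrow> word multiset \<Rightarrow> bool" where
  "available i S \<longleftrightarrow> (i, i) \<in># letters S \<or> (\<forall>l\<in>#letters S. fst l \<noteq> i \<and> snd l \<noteq> i)"

lemma reach_point: "reach S \<Longrightarrow> available i S \<Longrightarrow> reach (add_mset [(i, i)] S)"
  using reach.new[of S i] reach.fixed[of S i] unfolding available_def by metis

text \<open>Points come in twos: one enters as a fixed point of the product, the other joins it to
  the cycle.\<close>

lemma reach_odd_cycle:
  assumes "reach S" "available i S"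
  shows "reach (add_mset (replicate (Suc (2 * k)) (i, i)) S)"
proof (induction k)
  case 0
  then show ?case using reach_point[OF assms] by simp
next
  case (Suc k)
  let ?W = "replicate (Suc (2 * k)) (i, i)"
  have "reach (add_mset [(i, i)] (add_mset ?W S))"
    by (rule reach.fixed[OF Suc]) simp
  from reach.merge[OF this, of i i] show ?case by simp
qed

text \<open>An odd cycle of length \<open>a + b - 1\<close> is cut in two, and the cutting point is
  the missing letter.\<close>

lemma reach_even_cycles:
  assumes "reach S" "available i S" "even a" "even b" "a > 0" "b > 0"
  shows "reach (add_mset (replicate a (i, i)) (add_mset (replicate b (i, i)) S))"
proof -
  obtain a' b' where ab: "a = 2 * a'" "b = 2 * b'" using assms(3,4) by (auto elim!: evenE)
  have "Suc (2 * (a' + b' - 1)) = a + (b - 1)" using assms(5,6) ab by auto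
  then have "reach (add_mset (replicate a (i, i) @ replicate (b - 1) (i, i)) S)"
    using reach_odd_cycle[OF assms(1,2), of "a' + b' - 1"] by (simp only: replicate_add)
  from reach.split[OF this, of i i]
  have "reach (add_mset (replicate a (i, i)) (add_mset (replicate (b - 1) (i, i) @ [(i, i)]) S))"
    using assms(5) by (simp add: hd_replicate last_replicate)
  also have "replicate (b - 1) (i, i) @ [(i, i)] = replicate b (i, i)"
    using assms(6) by (metis Suc_diff_1 replicate_Suc replicate_append_same)
  finally show ?thesis .
qed

lemma reach_rot_last:
  assumes "reach (add_mset V S)" "l \<in> set V"
  obtains ys where "reach (add_mset (ys @ [l]) S)" "mset (ys @ [l]) = mset V"
proof -
  obtain us vs where V: "V = us @ l # vs" using split_list[OF assms(2)] by blast
  then have "reach (add_mset ((us @ [l]) @ vs) S)" using assms(1) by simp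
  from reach.rot[OF this] show thesis using that[of "vs @ us"] V by simp
qed

lemma reach_rot_hd:
  assumes "reach (add_mset V S)" "l \<in> set V"
  obtains ys where "reach (add_mset (l # ys) S)" "mset (l # ys) = mset V"
proof -
  obtain us vs where V: "V = us @ l # vs" using split_list[OF assms(2)] by blast
  then have "reach (add_mset (us @ (l # vs)) S)" using assms(1) by simp
  from reach.rot[OF this] show thesis using that[of "vs @ us"] V by simp
qed

text \<open>A cycle of the product that meets bin \<open>0\<close> in both factors can be prolonged by \<open>r\<close> points of bin \<open>i\<close>, at the
  cost of \<open>absorb_cost r\<close> further points of bin \<open>0\<close>.\<close>

definition absorb_cost :: "nat \<Rightarrow> nat" where
  "absorb_cost r = (if odd r then 1 else 2)"

definition absorbed :: "nat \<Rightarrow> nat \<Rightarrow> (nat \<times> nat) multiset" where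
  "absorbed i r = replicate_mset (r - 1) (i, i) + {#(i, 0), (0, i)#} + replicate_mset (absorb_cost r - 1) (0, 0)"

lemma reach_absorb:
  assumes "reach (add_mset V S)" and l: "l \<in> set V" "fst l = 0" "l' \<in> set V" "snd l' = 0"
    and av: "available i (add_mset V S)" and p: "(0, 0) \<in># letters (add_mset V S)" and r: "r \<ge> 2"
  obtains V' where "reach (add_mset V' S)" "mset V' = mset V + absorbed i r"
proof -
  obtain V0 where V1: "reach (add_mset (V0 @ [l']) S)" "mset (V0 @ [l']) = mset V"
    using reach_rot_last[OF assms(1) l(3)] .
  let ?V1 = "V0 @ [l']" and ?a = "(i, i)"
  have lV1: "l \<in> set ?V1" using mset_eq_setD[OF V1(2)] l(1) by auto
  have av1: "available i (add_mset ?V1 S)" and p1: "(0, 0) \<in># letters (add_mset ?V1 S)"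
    using av p V1(2) by (simp_all add: available_def)
  show thesis
  proof (cases "odd r")
    case True
    \<comment> \<open>The joining points \<open>(i, 0)\<close> and \<open>(0, i)\<close> must occur
      equally often, so that each bin has the same size in both factors. There are thus two mergers:
      the first attaches the odd cycle \<open>U\<close>, the second a further fixed point of bin
      \<open>i\<close>.\<close>
    then have "\<exists>k. r = 2 * k + 3" using r by presburger
    then obtain k where k: "r = 2 * k + 3" ..
    define U where "U = replicate (Suc (2 * k)) ?a"
    have U: "reach (add_mset U (add_mset ?V1 S))" unfolding U_def by (rule reach_odd_cycle[OF V1(1) av1])
    have "reach (add_mset [?a] (add_mset U (add_mset ?V1 S)))"
      by (rule reach.fixed[OF U]) (simp add: U_def)
    then have "reach (add_mset U (add_mset ?V1 (add_mset [?a] S)))"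
      by (simp add: add_mset_commute)
    from reach.merge[OF this, of i 0] have m1: "reach (add_mset (U @ [(i, 0)] @ ?V1) (add_mset [?a] S))"
      using l by (simp add: U_def)
    have "l \<in> set (U @ [(i, 0)] @ ?V1)" using lV1 by auto
    from reach_rot_hd[OF m1 this] obtain ys where ys: "reach (add_mset (l # ys) (add_mset [?a] S))"
        "mset (l # ys) = mset (U @ [(i, 0)] @ ?V1)" .
    from reach.merge[OF ys(1), of 0 i] have "reach (add_mset ((l # ys) @ [(0, i)] @ [?a]) S)"
      using l by simp
    moreover have "mset ((l # ys) @ [(0, i)] @ [?a]) = mset V + absorbed i r"
      using ys(2) V1(2) True k by (simp add: U_def absorbed_def absorb_cost_def)
    ultimately show thesis using that by blast
  next
    case False
    \<comment> \<open>For the parity of \<open>r\<close> the second merger must not attach a point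
      of bin \<open>i\<close>; a fixed point of bin \<open>0\<close> is attached instead, which
      raises the cost to 2.\<close>
    then have "\<exists>k. r = 2 * k + 2" using r by presburger
    then obtain k where k: "r = 2 * k + 2" ..
    define U where "U = replicate (Suc (2 * k)) ?a"
    have U: "reach (add_mset U (add_mset ?V1 S))" unfolding U_def by (rule reach_odd_cycle[OF V1(1) av1])
    have "reach (add_mset [(0, 0)] (add_mset U (add_mset ?V1 S)))"
      by (rule reach.fixed[OF U]) (use p1 in auto)
    then have "reach (add_mset U (add_mset ?V1 (add_mset [(0, 0)] S)))"
      by (simp add: add_mset_commute)
    from reach.merge[OF this, of i 0] have m1: "reach (add_mset (U @ [(i, 0)] @ ?V1) (add_mset [(0, 0)] S))"
      using l by (simp add: U_def)
    have "?a \<in> set (U @ [(i, 0)] @ ?V1)" by (simp add: U_def)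
    from reach_rot_last[OF m1 this] obtain ys where ys: "reach (add_mset (ys @ [?a]) (add_mset [(0, 0)] S))"
        "mset (ys @ [?a]) = mset (U @ [(i, 0)] @ ?V1)" .
    have "reach (add_mset [(0, 0)] (add_mset (ys @ [?a]) S))"
      using ys(1) by (simp add: add_mset_commute)
    from reach.merge[OF this, of 0 i] have "reach (add_mset ([(0, 0)] @ [(0, i)] @ ys @ [?a]) S)" by simp
    moreover have "mset ([(0, 0)] @ [(0, i)] @ ys @ [?a]) = mset V + absorbed i r"
      using ys(2) V1(2) False k by (simp add: U_def absorbed_def absorb_cost_def)
    ultimately show thesis using that by blast
  qed
qed

text \<open>The counterpart of absorption for a bin of one point. The new cycles of \<open>s\<close>
  and \<open>s'\<close> consist of different points, \<open>(i, 0)\<close> and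
  \<open>(0, i)\<close>, each of which lies in the main bin for the other factor.\<close>

lemma reach_absorb_new:
  assumes "reach (add_mset V S)" and l: "l \<in> set V" "fst l = 0" "l' \<in> set V" "snd l' = 0"
    and i: "i \<noteq> 0" "\<forall>l\<in>#letters (add_mset V S). fst l \<noteq> i \<and> snd l \<noteq> i"
  obtains V' where "reach (add_mset V' S)" "mset V' = mset V + {#(i, 0), (0, i)#}"
proof -
  obtain V0 where V1: "reach (add_mset (V0 @ [l']) S)" "mset (V0 @ [l']) = mset V"
    using reach_rot_last[OF assms(1) l(3)] .
  let ?V1 = "V0 @ [l']"
  have let1: "letters (add_mset ?V1 S) = letters (add_mset V S)" using V1(2) by simp
  have "reach (add_mset (?V1 @ [(i, 0)]) S)"
    by (rule reach.new_row[OF V1(1)]) (use let1 i l in auto)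
  moreover have "l \<in> set (?V1 @ [(i, 0)])" using mset_eq_setD[OF V1(2)] l(1) by auto
  ultimately obtain ys where ys: "reach (add_mset (l # ys) S)" "mset (l # ys) = mset (?V1 @ [(i, 0)])"
    using reach_rot_hd by blast
  have let2: "letters (add_mset (l # ys) S) = add_mset (i, 0) (letters (add_mset V S))"
    using ys(2) V1(2) by simp
  have "reach (add_mset ((l # ys) @ [(0, i)]) S)"
    by (rule reach.new_col[OF ys(1)]) (use let2 i l in auto)
  moreover have "mset ((l # ys) @ [(0, i)]) = mset V + {#(i, 0), (0, i)#}"
    using ys(2) V1(2) by simp
  ultimately show thesis using that by blast
qed

text \<open>The next lemmas let small cycles straddle bins \<open>0\<close> and \<open>i\<close>. They are needed for cycle lengths up to 4,
  which are too short for \<open>reach_absorb\<close>.\<close>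

lemma reach_equal_pair:
  assumes "reach S" "available i S" "available 0 S" "i \<noteq> 0" "n \<ge> 2"
  shows "reach (add_mset (replicate (n - 1) (0, 0) @ [(i, i)])
           (add_mset ((i, 0) # replicate (n - 2) (0, 0) @ [(0, i)]) S))"
proof -
  obtain k where k: "n = k + 2" using assms(5) by (metis le_Suc_ex add.commute)
  let ?p = "(0, 0) :: nat \<times> nat"
  \<comment> \<open>An odd cycle of \<open>2 * n - 3\<close> main points, a fixed point of bin
    \<open>i\<close>, a joining point and a cutting point make up the \<open>2 * n\<close>
    letters.\<close>
  have "Suc (2 * k) = k + (n - 1)" using k by simp
  then have "reach (add_mset (replicate k ?p @ replicate (n - 1) ?p) S)"
    using reach_odd_cycle[OF assms(1,3), of k] by (simp only: replicate_add)
  moreover have "available i (add_mset (replicate k ?p @ replicate (n - 1) ?p) S)"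
    using assms(2,4) by (auto simp: available_def)
  ultimately have "reach (add_mset [(i, i)] (add_mset (replicate k ?p @ replicate (n - 1) ?p) S))"
    by (rule reach_point)
  from reach.merge[OF this, of i 0]
  have "reach (add_mset (((i, i) # (i, 0) # replicate k ?p) @ replicate (n - 1) ?p) S)"
    using k by simp
  from reach.rot[OF this]
  have "reach (add_mset ((replicate (n - 1) ?p @ [(i, i)]) @ ((i, 0) # replicate k ?p)) S)" by simp
  from reach.split[OF this, of 0 i] show ?thesis using k by simp
qed

lemma reach_four_pair:
  assumes "reach S" "available i S" "available 0 S" "i \<noteq> 0"
  shows "reach (add_mset [(0, i), (i, i), (0, 0), (0, 0)]
           (add_mset [(0, 0), (i, i), (i, 0), (0, 0)] S))"
proof -
  let ?p = "(0, 0) :: nat \<times> nat" and ?a = "(i, i)"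
  have "reach (add_mset [?p, ?p, ?p] S)"
    using reach_odd_cycle[OF assms(1,3), of 1] by (simp add: numeral_eq_Suc)
  moreover have "available i (add_mset [?p, ?p, ?p] S)"
    using assms(2,4) by (auto simp: available_def)
  ultimately have 1: "reach (add_mset [?a] (add_mset [?p, ?p, ?p] S))"
    by (rule reach_point)
  have "reach (add_mset [?a] (add_mset [?a] (add_mset [?p, ?p, ?p] S)))"
    by (rule reach.fixed[OF 1]) simp
  then have "reach (add_mset [?a] (add_mset [?p, ?p, ?p] (add_mset [?a] S)))"
    by (simp add: add_mset_commute)
  from reach.merge[OF this, of i 0]
  have "reach (add_mset ([?a, (i, 0)] @ [?p, ?p, ?p]) (add_mset [?a] S))" by simp
  from reach.rot[OF this]
  have "reach (add_mset [?p, ?p, ?p, ?a, (i, 0)] (add_mset [?a] S))" by simp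
  from reach.merge[OF this, of 0 i]
  have "reach (add_mset ([?p, ?p, ?p, ?a, (i, 0)] @ [(0, i), ?a]) S)" by simp
  from reach.rot[OF this]
  have "reach (add_mset ([(0, i), ?a, ?p, ?p] @ [?p, ?a, (i, 0)]) S)" by simp
  from reach.split[OF this, of 0 0] show ?thesis by simp
qed

lemma reach_four_transpositions:
  assumes "reach S" "available i S" "available 0 S" "i \<noteq> 0"
  shows "reach (add_mset [(i, 0), (0, 0)] (add_mset [(0, i), (i, 0)]
           (add_mset [(i, i), (0, 0)] (add_mset [(0, 0), (0, i)] S))))"
proof -
  let ?p = "(0, 0) :: nat \<times> nat" and ?a = "(i, i)" and ?x = "(i, 0)" and ?y = "(0, i)"
  have "reach (add_mset [?p, ?p, ?p] S)"
    using reach_odd_cycle[OF assms(1,3), of 1] by (simp add: numeral_eq_Suc)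
  moreover have "available i (add_mset [?p, ?p, ?p] S)"
    using assms(2,4) by (auto simp: available_def)
  ultimately have "reach (add_mset [?a] (add_mset [?p, ?p, ?p] S))"
    by (rule reach_point)
  \<comment> \<open>One merger makes a 5-cycle; three cuts, each adding a letter, turn it into four
    transpositions.\<close>
  then have "reach (add_mset [?p, ?p, ?p] (add_mset [?a] S))" by (simp add: add_mset_commute)
  from reach.merge[OF this, of 0 i]
  have "reach (add_mset ([?p] @ [?p, ?p, ?y, ?a]) S)" by simp
  from reach.rot[OF this] have "reach (add_mset ([?p, ?p, ?y, ?a] @ [?p]) S)" by simp
  from reach.split[OF this, of 0 i]
  have "reach (add_mset ([?p, ?p, ?y] @ [?a]) (add_mset [?p, ?y] S))" by simp
  from reach.rot[OF this]
  have "reach (add_mset ([?a, ?p] @ [?p, ?y]) (add_mset [?p, ?y] S))" by simp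
  from reach.split[OF this, of i 0]
  have "reach (add_mset ([?p, ?y] @ [?x]) (add_mset [?a, ?p] (add_mset [?p, ?y] S)))"
    by (simp add: add_mset_commute)
  from reach.rot[OF this]
  have "reach (add_mset ([?x, ?p] @ [?y]) (add_mset [?a, ?p] (add_mset [?p, ?y] S)))" by simp
  from reach.split[OF this, of i 0] show ?thesis by simp
qed

lemma reach_new_transpositions:
  assumes "reach S" "available 0 S" "i \<noteq> 0" "\<forall>l\<in>#letters S. fst l \<noteq> i \<and> snd l \<noteq> i"
  shows "reach (add_mset [(0, 0), (i, 0)] (add_mset [(0, 0), (0, i)] S))"
proof -
  let ?p = "(0, 0) :: nat \<times> nat"
  have 1: "reach (add_mset [?p] S)" by (rule reach_point[OF assms(1,2)])
  have "reach (add_mset [?p] (add_mset [?p] S))" by (rule reach.fixed[OF 1]) simp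
  then have "reach (add_mset ([?p] @ [(i, 0)]) (add_mset [?p] S))"
    by (rule reach.new_row) (use assms(3,4) in auto)
  then have "reach (add_mset [?p] (add_mset [?p, (i, 0)] S))" by (simp add: add_mset_commute)
  then have "reach (add_mset ([?p] @ [(0, i)]) (add_mset [?p, (i, 0)] S))"
    by (rule reach.new_col) (use assms(3,4) in auto)
  then show ?thesis by (simp add: add_mset_commute)
qed


section \<open>Bin sizes and states of the construction\<close>

definition row_count :: "nat \<Rightarrow> (nat \<times> nat) multiset \<Rightarrow> nat" where
  "row_count j M = size (filter_mset (\<lambda>l. fst l = j) M)"

definition col_count :: "nat \<Rightarrow> (nat \<times> nat) multiset \<Rightarrow> nat" where
  "col_count j M = size (filter_mset (\<lambda>l. snd l = j) M)"

lemma filter_replicate: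
  "filter_mset P (replicate_mset n l) = (if P l then replicate_mset n l else {#})"
  by (induction n) auto

lemma count_simps [simp]:
  "row_count j {#} = 0" "row_count j (add_mset l M) = (if fst l = j then 1 else 0) + row_count j M"
  "row_count j (M + N) = row_count j M + row_count j N"
  "row_count j (replicate_mset n l) = (if fst l = j then n else 0)"
  "col_count j {#} = 0" "col_count j (add_mset l M) = (if snd l = j then 1 else 0) + col_count j M"
  "col_count j (M + N) = col_count j M + col_count j N"
  "col_count j (replicate_mset n l) = (if snd l = j then n else 0)"
  by (simp_all add: row_count_def col_count_def filter_replicate)

lemma count_eq_0:
  "row_count j M = 0 \<Longrightarrow> l \<in># M \<Longrightarrow> fst l \<noteq> j" "col_count j M = 0 \<Longrightarrow> l \<in># M \<Longrightarrow> snd l \<noteq> j"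
  unfolding row_count_def col_count_def size_eq_0_iff_empty filter_mset_eq_mempty_iff by blast+

text \<open>The two letters may differ: absorption attaches through the first factor at one point
  and through the second at another.\<close>

definition meets_main :: "word \<Rightarrow> bool" where
  "meets_main w \<longleftrightarrow> (\<exists>l\<in>set w. fst l = 0) \<and> (\<exists>l\<in>set w. snd l = 0)"

definition has_counts :: "(nat \<Rightarrow> nat) \<Rightarrow> (nat \<times> nat) multiset \<Rightarrow> bool" where
  "has_counts L M \<longleftrightarrow> (\<forall>j. row_count j M = L j \<and> col_count j M = L j)"

text \<open>The last two conjuncts keep bins \<open>0\<close> and \<open>i\<close>
  available.\<close>

definition state :: "(nat \<Rightarrow> nat) \<Rightarrow> nat \<Rightarrow> word multiset \<Rightarrow> word multiset \<Rightarrow> bool" where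
  "state L i S T \<longleftrightarrow> reach (S + T) \<and> (\<forall>w\<in>#T. meets_main w) \<and> has_counts L (letters (S + T)) \<and>
     (0, 0) \<in># letters (S + T) \<and> (L i = 0 \<or> (i, i) \<in># letters (S + T))"

text \<open>\<open>L\<close> prescribes the common cycle lengths of the two factors, \<open>N + D\<close> the cycle type of the product. The cycles
  counted by \<open>D\<close> meet bin \<open>0\<close>, so that they can still be prolonged; \<open>i\<close> is the bin under construction.\<close>

definition realizable :: "(nat \<Rightarrow> nat) \<Rightarrow> nat \<Rightarrow> nat multiset \<Rightarrow> nat multiset \<Rightarrow> bool" where
  "realizable L i N D \<longleftrightarrow> (\<exists>S T. state L i S T \<and> image_mset length S = N \<and> image_mset length T = D)"

lemma state_available:
  assumes "state L i S T"
  shows "available i (S + T)" "available 0 (S + T)"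
proof -
  show "available 0 (S + T)" using assms by (simp add: state_def available_def)
  have "\<forall>l\<in>#letters (S + T). fst l \<noteq> i \<and> snd l \<noteq> i" if "L i = 0"
    using that assms count_eq_0[of i "letters (S + T)"] unfolding state_def has_counts_def by metis
  then show "available i (S + T)" using assms unfolding state_def available_def by metis
qed

lemma stateI:
  assumes "state L i S T" "reach (S' + T')" "\<forall>w\<in>#T'. meets_main w"
    and "letters (S' + T') = letters (S + T) + M"
    and "\<And>j. L' j = L j + row_count j M" "\<And>j. L' j = L j + col_count j M"
    and "L' i = L i \<or> (i, i) \<in># M"
  shows "state L' i S' T'"
  unfolding state_def has_counts_def
proof (intro conjI allI)
  have st: "has_counts L (letters (S + T))" "(0, 0) \<in># letters (S + T)" "L i = 0 \<or> (i, i) \<in># letters (S + T)"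
    using assms(1) by (simp_all add: state_def)
  show "reach (S' + T')" "\<forall>w\<in>#T'. meets_main w" by (rule assms)+
  show "row_count j (letters (S' + T')) = L' j" "col_count j (letters (S' + T')) = L' j" for j
    using st(1) assms(5,6)[of j] unfolding assms(4) has_counts_def by simp_all
  show "(0, 0) \<in># letters (S' + T')" using st(2) unfolding assms(4) by simp
  show "L' i = 0 \<or> (i, i) \<in># letters (S' + T')" using st(3) assms(7) unfolding assms(4) by auto
qed

lemma realizable_forget: "realizable L i N (add_mset b D) \<Longrightarrow> realizable L i (add_mset b N) D"
proof -
  assume "realizable L i N (add_mset b D)"
  then obtain S T where st: "state L i S T" "image_mset length S = N" "image_mset length T = add_mset b D"
    by (auto simp: realizable_def)
  obtain w T' where T: "T = add_mset w T'" "length w = b" "image_mset length T' = D"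
    using msed_map_invR[OF st(3)] by metis
  have "state L i (add_mset w S) T'" using st(1) T(1) by (simp add: state_def)
  then show ?thesis using st(2) T unfolding realizable_def by (metis image_mset_add_mset)
qed

lemma realizable_switch: "realizable L i N D \<Longrightarrow> L j = 0 \<Longrightarrow> realizable L j N D"
proof -
  assume "realizable L i N D" "L j = 0"
  then obtain S T where "state L i S T" "image_mset length S = N" "image_mset length T = D"
    by (auto simp: realizable_def)
  moreover from this \<open>L j = 0\<close> have "state L j S T" by (simp add: state_def)
  ultimately show "realizable L j N D" unfolding realizable_def by blast
qed

lemma realizable_odd:
  assumes "realizable L i N D" "odd n" "i \<noteq> 0"
  shows "realizable (L(i := L i + n)) i (add_mset n N) D"
proof -
  obtain S T where st: "state L i S T" "image_mset length S = N" "image_mset length T = D"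
    using assms(1) by (auto simp: realizable_def)
  obtain k where k: "n = Suc (2 * k)" using assms(2) by (auto elim!: oddE)
  let ?w = "replicate n (i, i)"
  have "reach (add_mset ?w (S + T))"
    using reach_odd_cycle[of "S + T" i k] state_available[OF st(1)] st(1) k by (simp add: state_def)
  then have "state (L(i := L i + n)) i (add_mset ?w S) T"
    by (intro stateI[OF st(1), where M = "replicate_mset n (i, i)"])
      (use st(1) k in \<open>auto simp: state_def\<close>)
  then show ?thesis using st unfolding realizable_def by (metis image_mset_add_mset length_replicate)
qed

lemma realizable_even:
  assumes "realizable L i N D" "even a" "even b" "a > 0" "b > 0" "i \<noteq> 0"
  shows "realizable (L(i := L i + (a + b))) i (add_mset a (add_mset b N)) D"
proof -
  obtain S T where st: "state L i S T" "image_mset length S = N" "image_mset length T = D"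
    using assms(1) by (auto simp: realizable_def)
  let ?w = "\<lambda>n. replicate n (i, i)"
  have "reach (add_mset (?w a) (add_mset (?w b) (S + T)))"
    using reach_even_cycles[of "S + T" i a b] state_available[OF st(1)] st(1) assms by (simp add: state_def)
  then have "state (L(i := L i + (a + b))) i (add_mset (?w a) (add_mset (?w b) S)) T"
    by (intro stateI[OF st(1), where M = "replicate_mset a (i, i) + replicate_mset b (i, i)"])
      (use st(1) assms in \<open>auto simp: state_def\<close>)
  then show ?thesis using st unfolding realizable_def by (metis image_mset_add_mset length_replicate)
qed

lemma realizable_absorb:
  assumes "realizable L i N (add_mset c D)" "r \<ge> 2" "i \<noteq> 0"
  shows "realizable (L(i := L i + r, 0 := L 0 + absorb_cost r)) i N (add_mset (c + r + absorb_cost r) D)"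
proof -
  obtain S T where st: "state L i S T" "image_mset length S = N" "image_mset length T = add_mset c D"
    using assms(1) by (auto simp: realizable_def)
  obtain w T' where T: "T = add_mset w T'" "length w = c" "image_mset length T' = D"
    using msed_map_invR[OF st(3)] by metis
  have "meets_main w" using st(1) T(1) by (simp add: state_def)
  then obtain l l' where l: "l \<in> set w" "fst l = 0" "l' \<in> set w" "snd l' = 0"
    by (auto simp: meets_main_def)
  have "reach (add_mset w (S + T'))" "available i (add_mset w (S + T'))"
    "(0, 0) \<in># letters (add_mset w (S + T'))"
    using st(1) T(1) state_available(1)[OF st(1)] by (simp_all add: state_def)
  from reach_absorb[OF this(1) l this(2,3) assms(2)]
  obtain w' where w': "reach (add_mset w' (S + T'))" "mset w' = mset w + absorbed i r" .
  have cost: "absorb_cost r \<ge> 1" by (simp add: absorb_cost_def)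
  have "set w \<subseteq> set w'" using w'(2) by (metis mset_subset_eq_add_left set_mset_mono set_mset_mset)
  then have "meets_main w'" using l by (auto simp: meets_main_def)
  then have "state (L(i := L i + r, 0 := L 0 + absorb_cost r)) i S (add_mset w' T')"
    by (intro stateI[OF st(1), where M = "absorbed i r"])
      (use st(1) w' T assms(2,3) cost in \<open>auto simp: state_def absorbed_def\<close>)
  moreover have "length w' = c + r + absorb_cost r"
    using arg_cong[OF w'(2), of size] T(2) assms(2) cost by (simp add: absorbed_def)
  ultimately show ?thesis using st(2) T(3) unfolding realizable_def by (metis image_mset_add_mset)
qed

text \<open>Bin \<open>i\<close> ends up with \<open>(i, 0)\<close> and \<open>(0, i)\<close> but
  without \<open>(i, i)\<close>, hence is no longer available. It is closed at once, and the state
  refers to another empty bin \<open>j\<close>.\<close>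

lemma realizable_absorb_new:
  assumes "realizable L i N (add_mset c D)" "L i = 0" "i \<noteq> 0" "L j = 0" "j \<noteq> i" "j \<noteq> 0"
  shows "realizable (L(i := 1, 0 := L 0 + 1)) j N (add_mset (c + 2) D)"
proof -
  have "realizable L j N (add_mset c D)" using realizable_switch[OF assms(1,4)] .
  then obtain S T where st: "state L j S T" "image_mset length S = N" "image_mset length T = add_mset c D"
    by (auto simp: realizable_def)
  obtain w T' where T: "T = add_mset w T'" "length w = c" "image_mset length T' = D"
    using msed_map_invR[OF st(3)] by metis
  have "meets_main w" using st(1) T(1) by (simp add: state_def)
  then obtain l l' where l: "l \<in> set w" "fst l = 0" "l' \<in> set w" "snd l' = 0"
    by (auto simp: meets_main_def)
  have r: "reach (add_mset w (S + T'))" using st(1) T(1) by (simp add: state_def)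
  have "\<forall>l\<in>#letters (add_mset w (S + T')). fst l \<noteq> i \<and> snd l \<noteq> i"
    using st(1) assms(2) count_eq_0[of i "letters (S + T)"] T(1) by (simp add: state_def has_counts_def)
  from reach_absorb_new[OF r l assms(3) this]
  obtain w' where w': "reach (add_mset w' (S + T'))" "mset w' = mset w + {#(i, 0), (0, i)#}" .
  have "set w \<subseteq> set w'" using w'(2) by (metis mset_subset_eq_add_left set_mset_mono set_mset_mset)
  then have "meets_main w'" using l by (auto simp: meets_main_def)
  then have "state (L(i := 1, 0 := L 0 + 1)) j S (add_mset w' T')"
    by (intro stateI[OF st(1), where M = "{#(i, 0), (0, i)#}"])
      (use st(1) w' T assms in \<open>auto simp: state_def\<close>)
  moreover have "length w' = c + 2" using arg_cong[OF w'(2), of size] T(2) by simp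
  ultimately show ?thesis using st(2) T(3) unfolding realizable_def by (metis image_mset_add_mset)
qed

lemma realizable_equal_pair:
  assumes "realizable L i N D" "n \<ge> 2" "i \<noteq> 0"
  shows "realizable (L(i := L i + 2, 0 := L 0 + (2 * n - 2))) i (add_mset n (add_mset n N)) D"
proof -
  obtain S T where st: "state L i S T" "image_mset length S = N" "image_mset length T = D"
    using assms(1) by (auto simp: realizable_def)
  let ?u = "replicate (n - 1) (0, 0) @ [(i, i)]" and ?v = "(i, 0) # replicate (n - 2) (0, 0) @ [(0, i)]"
  have "reach (add_mset ?u (add_mset ?v (S + T)))"
    using reach_equal_pair[OF _ state_available[OF st(1)] assms(3,2)] st(1) by (simp add: state_def)
  then have "state (L(i := L i + 2, 0 := L 0 + (2 * n - 2))) i (add_mset ?u (add_mset ?v S)) T"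
    by (intro stateI[OF st(1), where M = "mset ?u + mset ?v"])
      (use st(1) assms in \<open>auto simp: state_def\<close>)
  moreover have "length ?u = n" "length ?v = n" using assms(2) by auto
  ultimately show ?thesis using st(2,3) unfolding realizable_def by (metis image_mset_add_mset)
qed

lemma realizable_four_pair:
  assumes "realizable L i N D" "i \<noteq> 0"
  shows "realizable (L(i := L i + 3, 0 := L 0 + 5)) i (add_mset 4 (add_mset 4 N)) D"
proof -
  obtain S T where st: "state L i S T" "image_mset length S = N" "image_mset length T = D"
    using assms(1) by (auto simp: realizable_def)
  let ?u = "[(0, i), (i, i), (0, 0), (0, 0)]" and ?v = "[(0, 0), (i, i), (i, 0), (0, 0)]"
  have "reach (add_mset ?u (add_mset ?v (S + T)))"
    using reach_four_pair[OF _ state_available[OF st(1)] assms(2)] st(1) by (simp add: state_def)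
  then have "state (L(i := L i + 3, 0 := L 0 + 5)) i (add_mset ?u (add_mset ?v S)) T"
    by (intro stateI[OF st(1), where M = "mset ?u + mset ?v"])
      (use st(1) assms in \<open>auto simp: state_def\<close>)
  moreover have "image_mset length (add_mset ?u (add_mset ?v S)) = add_mset 4 (add_mset 4 N)"
    using st(2) by (simp add: numeral_eq_Suc)
  ultimately show ?thesis using st(3) unfolding realizable_def by blast
qed

lemma realizable_four_transpositions:
  assumes "realizable L i N D" "i \<noteq> 0"
  shows "realizable (L(i := L i + 3, 0 := L 0 + 5)) i (replicate_mset 4 2 + N) D"
proof -
  obtain S T where st: "state L i S T" "image_mset length S = N" "image_mset length T = D"
    using assms(1) by (auto simp: realizable_def)
  let ?S = "add_mset [(i, 0), (0, 0)] (add_mset [(0, i), (i, 0)]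
           (add_mset [(i, i), (0, 0)] (add_mset [(0, 0), (0, i)] S)))"
  have "reach (?S + T)"
    using reach_four_transpositions[OF _ state_available[OF st(1)] assms(2)] st(1) by (simp add: state_def)
  then have "state (L(i := L i + 3, 0 := L 0 + 5)) i ?S T"
    by (intro stateI[OF st(1), where M = "{#(i, 0), (0, 0), (0, i), (i, 0), (i, i), (0, 0), (0, 0), (0, i)#}"])
      (use st(1) assms in \<open>auto simp: state_def\<close>)
  moreover have "image_mset length ?S = replicate_mset 4 2 + N"
    using st(2) by (simp add: numeral_eq_Suc)
  ultimately show ?thesis using st(3) unfolding realizable_def by blast
qed

lemma realizable_new_transpositions:
  assumes "realizable L i N D" "L i = 0" "i \<noteq> 0" "L j = 0" "j \<noteq> i" "j \<noteq> 0"
  shows "realizable (L(i := 1, 0 := L 0 + 3)) j (add_mset 2 (add_mset 2 N)) D"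
proof -
  have "realizable L j N D" using realizable_switch[OF assms(1,4)] .
  then obtain S T where st: "state L j S T" "image_mset length S = N" "image_mset length T = D"
    by (auto simp: realizable_def)
  let ?S = "add_mset [(0, 0), (i, 0)] (add_mset [(0, 0), (0, i)] S)"
  have "\<forall>l\<in>#letters (S + T). fst l \<noteq> i \<and> snd l \<noteq> i"
    using st(1) assms(2) count_eq_0[of i "letters (S + T)"] by (simp add: state_def has_counts_def)
  then have "reach (?S + T)"
    using reach_new_transpositions[OF _ state_available(2)[OF st(1)] assms(3)] st(1) by (simp add: state_def)
  then have "state (L(i := 1, 0 := L 0 + 3)) j ?S T"
    by (intro stateI[OF st(1), where M = "{#(0, 0), (i, 0), (0, 0), (0, i)#}"])
      (use st(1) assms in \<open>auto simp: state_def\<close>)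
  moreover have "image_mset length ?S = add_mset 2 (add_mset 2 N)"
    using st(2) by (simp add: numeral_eq_Suc)
  ultimately show ?thesis using st(3) unfolding realizable_def by blast
qed

text \<open>The cycle types of even permutations: the number of points and the number of cycles have
  the same parity.\<close>

definition even_type :: "nat multiset \<Rightarrow> bool" where
  "even_type N \<longleftrightarrow> even (sum_mset N + size N) \<and> 0 \<notin># N"

text \<open>Odd cycles are placed singly and even ones in pairs; parity rules out that one even
  cycle is left over.\<close>

lemma reach_pack:
  assumes "even_type N"
  shows "\<exists>T. reach T \<and> image_mset length T = N \<and> set_mset (letters T) \<subseteq> {(0, 0)}"
  using assms
proof (induction "size N" arbitrary: N rule: less_induct)
  case less
  consider "N = {#}" | a N' where "N = add_mset a N'" "odd a"
    | a b N' where "N = add_mset a (add_mset b N')" "even a" "even b"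
    | a where "N = {#a#}" "even a"
  proof (cases "\<exists>a\<in>#N. odd a")
    case True
    then show ?thesis using that(2) by (metis insert_DiffM)
  next
    case False
    then show ?thesis
    proof (cases N)
      case (add a N')
      then show ?thesis using False that(3,4) by (cases N') auto
    qed (use that(1) in simp)
  qed
  then show ?case
  proof cases
    case 1
    then show ?thesis using reach.empty by (intro exI[of _ "{#}"]) simp
  next
    case (2 a N')
    then have "even_type N'" using less.prems by (auto simp: even_type_def)
    then obtain T where T: "reach T" "image_mset length T = N'" "set_mset (letters T) \<subseteq> {(0, 0)}"
      using less.hyps[of N'] 2 by auto
    have "available 0 T" using T(3) by (auto simp: available_def)
    moreover obtain k where "a = Suc (2 * k)" using 2(2) by (auto elim!: oddE)
    ultimately have "reach (add_mset (replicate a (0, 0)) T)" using reach_odd_cycle[OF T(1)] by simp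
    then show ?thesis using T 2 by (intro exI[of _ "add_mset (replicate a (0, 0)) T"]) auto
  next
    case (3 a b N')
    then have N': "even_type N'" "a > 0" "b > 0" using less.prems by (auto simp: even_type_def)
    then obtain T where T: "reach T" "image_mset length T = N'" "set_mset (letters T) \<subseteq> {(0, 0)}"
      using less.hyps[of N'] 3 by auto
    have "available 0 T" using T(3) by (auto simp: available_def)
    from reach_even_cycles[OF T(1) this 3(2,3) N'(2,3)] show ?thesis using T 3
      by (intro exI[of _ "add_mset (replicate a (0, 0)) (add_mset (replicate b (0, 0)) T)"]) auto
  next
    case (4 a)
    then show ?thesis using less.prems by (simp add: even_type_def)
  qed
qed

lemma letters_length: "size (letters T) = sum_mset (image_mset length T)"
  by (induction T) auto

lemma realizable_main:
  assumes "even_type N" "N \<noteq> {#}" "i \<noteq> 0"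
  shows "realizable ((\<lambda>_. 0)(0 := sum_mset N)) i {#} N"
proof -
  obtain T where T: "reach T" "image_mset length T = N" "set_mset (letters T) \<subseteq> {(0, 0)}"
    using reach_pack[OF assms(1)] by blast
  have eq: "letters T = replicate_mset (sum_mset N) (0, 0)"
    using T(2,3) letters_length[of T] by (metis set_mset_subset_singletonD)
  have pos: "0 \<notin># N" using assms(1) by (simp add: even_type_def)
  have "meets_main w" if w: "w \<in># T" for w
  proof -
    have "length w \<in># N" using w T(2) by auto
    then have "w \<noteq> []" using pos by auto
    moreover have "set w \<subseteq> {(0, 0)}" using T(3) w by (force simp: letters_def)
    ultimately have "(0, 0) \<in> set w" by (cases w) auto
    then show ?thesis by (force simp: meets_main_def)
  qed
  moreover have "(0, 0) \<in># letters T"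
  proof -
    obtain x where "x \<in># N" using assms(2) by (meson multiset_nonemptyE)
    then have "sum_mset N \<noteq> 0" using pos by (metis sum_mset_0_iff)
    then show ?thesis by (simp add: eq)
  qed
  ultimately have "state ((\<lambda>_. 0)(0 := sum_mset N)) i {#} T"
    using T(1) assms(3) by (auto simp: state_def has_counts_def eq)
  then show ?thesis using T(2) unfolding realizable_def by (metis image_mset_empty)
qed

section \<open>Realizing every even cycle type\<close>

lemma realizable_forget_mset: "realizable L i M (N + D) \<Longrightarrow> realizable L i (M + N) D"
proof (induction N arbitrary: M)
  case (add b N)
  then have "realizable L i (add_mset b M) (N + D)" using realizable_forget by simp
  then show ?case using add.IH by fastforce
qed simp

definition sizes :: "nat \<Rightarrow> nat list \<Rightarrow> nat \<Rightarrow> nat" where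
  "sizes N ms j = (if j = 0 then N else if j \<le> length ms then ms ! (j - 1) else 0)"

text \<open>The bins of \<open>ms\<close> are finished, and the next one has reached
  \<open>m\<close> points. Undoing the last step passes to a smaller \<open>m\<close>; at
  \<open>m = 0\<close> only the bins of \<open>ms\<close> remain.\<close>

definition bins_realizable :: "nat \<Rightarrow> nat list \<Rightarrow> nat \<Rightarrow> nat multiset \<Rightarrow> nat multiset \<Rightarrow> bool" where
  "bins_realizable N ms m V D \<longleftrightarrow> realizable ((sizes N ms)(Suc (length ms) := m)) (Suc (length ms)) V D"

lemma sizes_simps [simp]:
  "sizes N ms 0 = N" "sizes N ms (Suc (length ms)) = 0" "sizes N ms (Suc (Suc (length ms))) = 0"
  by (simp_all add: sizes_def)

lemma sizes_append: "sizes N (ms @ [m]) = (sizes N ms)(Suc (length ms) := m)"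
  by (rule ext) (auto simp: sizes_def nth_append)

lemma sizes_upd_0: "((sizes N ms)(Suc (length ms) := m))(0 := N') = (sizes N' ms)(Suc (length ms) := m)"
  by (rule ext) (auto simp: sizes_def)

lemma bins_realizable_forget:
  "bins_realizable N ms m V (add_mset b D) \<Longrightarrow> bins_realizable N ms m (add_mset b V) D"
  unfolding bins_realizable_def by (rule realizable_forget)

lemma bins_realizable_append:
  "bins_realizable N ms m V D \<Longrightarrow> bins_realizable N (ms @ [m]) 0 V D"
proof -
  assume "bins_realizable N ms m V D"
  then have "realizable (sizes N (ms @ [m])) (Suc (length ms)) V D" by (simp add: bins_realizable_def sizes_append)
  from realizable_switch[OF this, of "Suc (length (ms @ [m]))"]
  have "realizable (sizes N (ms @ [m])) (Suc (length (ms @ [m]))) V D" using sizes_simps(2)[of N "ms @ [m]"] by simp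
  then show ?thesis unfolding bins_realizable_def using sizes_simps(2)[of N "ms @ [m]"] by (metis fun_upd_triv)
qed

lemma bins_realizable_odd:
  "bins_realizable N ms m V D \<Longrightarrow> odd n \<Longrightarrow> bins_realizable N ms (m + n) (add_mset n V) D"
  unfolding bins_realizable_def by (drule realizable_odd) simp_all

lemma bins_realizable_even:
  "bins_realizable N ms m V D \<Longrightarrow> even a \<Longrightarrow> even b \<Longrightarrow> a > 0 \<Longrightarrow> b > 0 \<Longrightarrow>
    bins_realizable N ms (m + (a + b)) (add_mset a (add_mset b V)) D"
  unfolding bins_realizable_def by (drule realizable_even) simp_all

lemma bins_realizable_absorb:
  "bins_realizable N ms m V (add_mset c D) \<Longrightarrow> r \<ge> 2 \<Longrightarrow>
    bins_realizable (N + absorb_cost r) ms (m + r) V (add_mset (c + r + absorb_cost r) D)"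
  unfolding bins_realizable_def by (drule realizable_absorb) (simp_all add: sizes_upd_0)

lemma bins_realizable_absorb_new:
  "bins_realizable N ms 0 V (add_mset c D) \<Longrightarrow> bins_realizable (N + 1) (ms @ [1]) 0 V (add_mset (c + 2) D)"
proof -
  assume "bins_realizable N ms 0 V (add_mset c D)"
  from realizable_absorb_new[OF this[unfolded bins_realizable_def], of "Suc (Suc (length ms))"]
  have "realizable (sizes (N + 1) (ms @ [1])) (Suc (Suc (length ms))) V (add_mset (c + 2) D)"
    by (simp add: sizes_upd_0 sizes_append)
  then show ?thesis unfolding bins_realizable_def using sizes_simps(2)[of "N + 1" "ms @ [1]"] by (simp add: fun_upd_idem)
qed

lemma bins_realizable_equal_pair:
  "bins_realizable N ms m V D \<Longrightarrow> n \<ge> 2 \<Longrightarrow>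
    bins_realizable (N + (2 * n - 2)) ms (m + 2) (add_mset n (add_mset n V)) D"
proof -
  assume "bins_realizable N ms m V D" "n \<ge> 2"
  moreover have "((sizes N ms)(Suc (length ms) := m))(Suc (length ms) := m + 2, 0 := N + (2 * n - 2))
      = (sizes (N + (2 * n - 2)) ms)(Suc (length ms) := m + 2)"
    by (rule ext) (simp add: sizes_def)
  ultimately show ?thesis
    using realizable_equal_pair[of "(sizes N ms)(Suc (length ms) := m)" "Suc (length ms)" V D n] by (simp add: bins_realizable_def)
qed

lemma bins_realizable_four_pair:
  "bins_realizable N ms m V D \<Longrightarrow> bins_realizable (N + 5) ms (m + 3) (add_mset 4 (add_mset 4 V)) D"
  unfolding bins_realizable_def by (drule realizable_four_pair) (simp_all add: sizes_upd_0)

lemma bins_realizable_four_transpositions: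
  "bins_realizable N ms m V D \<Longrightarrow> bins_realizable (N + 5) ms (m + 3) (replicate_mset 4 2 + V) D"
  unfolding bins_realizable_def by (drule realizable_four_transpositions) (simp_all add: sizes_upd_0)

lemma bins_realizable_new_transpositions:
  "bins_realizable N ms 0 V D \<Longrightarrow> bins_realizable (N + 3) (ms @ [1]) 0 (add_mset 2 (add_mset 2 V)) D"
proof -
  assume "bins_realizable N ms 0 V D"
  from realizable_new_transpositions[OF this[unfolded bins_realizable_def], of "Suc (Suc (length ms))"]
  have "realizable (sizes (N + 3) (ms @ [1])) (Suc (Suc (length ms))) (add_mset 2 (add_mset 2 V)) D"
    by (simp add: sizes_upd_0 sizes_append)
  then show ?thesis unfolding bins_realizable_def using sizes_simps(2)[of "N + 3" "ms @ [1]"] by (simp add: fun_upd_idem)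
qed

text \<open>The main bin pays a bounded number of points for every other bin; 260 is a generous allowance.
  In \<open>D\<close> we collect short remainders (of length at most 12) of cycles that have been absorbed into bins:
  they are left alone and finally put into the main bin.\<close>

definition size_bound :: "nat list \<Rightarrow> nat" where
  "size_bound ms = sum_list ms + 260 * length ms + 1"

definition admissible :: "nat list \<Rightarrow> nat \<Rightarrow> nat \<Rightarrow> nat multiset \<Rightarrow> nat multiset \<Rightarrow> bool" where
  "admissible ms N m V D \<longleftrightarrow> even_type (V + D) \<and> (\<forall>d\<in>#D. d \<le> 12) \<and>
     N + sum_list ms + m = sum_mset V + sum_mset D"

text \<open>The distinguished cycle \<open>b\<close> is of arbitrary length: it is what remains of a long cycle, the rest of which
  has been absorbed by earlier bins.\<close>

definition always_realizable :: "nat list \<Rightarrow> bool" where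
  "always_realizable ms \<longleftrightarrow> (\<forall>N V D b. even_type (add_mset b V + D) \<longrightarrow> (\<forall>d\<in>#D. d \<le> 12) \<longrightarrow>
     N + sum_list ms = sum_mset V + sum_mset D + b \<longrightarrow> size_bound ms \<le> sum_mset V + b \<longrightarrow>
     bins_realizable N ms 0 V (add_mset b D))"

lemma always_realizableD:
  assumes "always_realizable ms" "even_type (add_mset b V + D)" "\<forall>d\<in>#D. d \<le> 12"
    "N + sum_list ms = sum_mset V + sum_mset D + b" "size_bound ms \<le> sum_mset V + b"
  shows "bins_realizable N ms 0 V (add_mset b D)"
  using assms unfolding always_realizable_def by blast

text \<open>Any cycle of \<open>V\<close> can play the part of \<open>b\<close>: a cycle that could
  still be prolonged may also be left as it is.\<close>

lemma always_realizable_all_small: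
  assumes "always_realizable ms" "admissible ms N 0 V D" "size_bound ms \<le> sum_mset V"
  shows "bins_realizable N ms 0 V D"
proof -
  have "V \<noteq> {#}" using assms(3) by (auto simp: size_bound_def)
  then obtain b V' where V: "V = add_mset b V'" by (meson multiset_cases)
  have "bins_realizable N ms 0 V' (add_mset b D)"
    by (rule always_realizableD[OF assms(1)]) (use assms V in \<open>auto simp: admissible_def\<close>)
  then show ?thesis using bins_realizable_forget V by simp
qed

section \<open>Filling the bin under construction\<close>

lemma absorb_cost_even: "even (r + absorb_cost r)" and absorb_cost_bounds: "1 \<le> absorb_cost r" "absorb_cost r \<le> 2"
  by (auto simp: absorb_cost_def)

lemma even_type_add: "even_type (add_mset a M) \<longleftrightarrow> a > 0 \<and> (even_type M \<longleftrightarrow> odd a) \<and> 0 \<notin># M"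
  by (auto simp: even_type_def)

lemma even_type_0: "even_type M \<Longrightarrow> 0 \<notin># M"
  by (simp add: even_type_def)

lemma sum_mset_remove: "L \<in># V \<Longrightarrow> sum_mset V = L + sum_mset (V - {#L#})" for L :: nat
  by (auto dest!: multi_member_split)

text \<open>One cycle can fill all the free points: as the cost is at most 2,
  \<open>m + 3 \<le> L\<close> leaves a rest of length at least 1. This rest may be long and becomes
  the distinguished cycle for the earlier bins.\<close>

lemma absorb_last:
  assumes "always_realizable ms" "admissible ms N m V D" "L \<in># V" "m + 3 \<le> L" "m \<ge> 2" "m + size_bound ms + 2 \<le> sum_mset V"
  shows "bins_realizable N ms m V D"
proof -
  obtain V' where V: "V = add_mset L V'" using assms(3) by (metis insert_DiffM)
  let ?g = "absorb_cost m"
  note g = absorb_cost_bounds[of m]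
  define b where "b = L - m - ?g"
  have L: "L = b + m + ?g" "b \<ge> 1" using assms(4) g by (auto simp: b_def)
  have par: "odd b \<longleftrightarrow> odd L" using absorb_cost_even[of m] L(1) by (metis add.assoc even_add)
  have N: "N \<ge> 2" using assms(2,6) by (auto simp: admissible_def size_bound_def)
  have "bins_realizable (N - ?g) ms 0 V' (add_mset b D)"
  proof (rule always_realizableD[OF assms(1)])
    show "even_type (add_mset b V' + D)" using assms(2) V L par by (auto simp: admissible_def even_type_add)
    show "\<forall>d\<in>#D. d \<le> 12" using assms(2) by (simp add: admissible_def)
    show "N - ?g + sum_list ms = sum_mset V' + sum_mset D + b" using assms(2) N V L g by (simp add: admissible_def)
    show "size_bound ms \<le> sum_mset V' + b" using assms(6) V L g by simp
  qed
  from bins_realizable_absorb[OF this assms(5)] have "bins_realizable N ms m V' (add_mset L D)" using N L g by (simp add: add.commute)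
  then show ?thesis using bins_realizable_forget V by simp
qed

text \<open>The bin is not yet full after this absorption, so the rest of the cycle has to be short
  enough for \<open>D\<close>. Filling the other \<open>m - r\<close> points is left to the
  hypothesis \<open>rest\<close>, which the callers obtain from their inductions.\<close>

lemma absorb_part:
  assumes ok: "admissible ms N m V D" and L: "L \<in># V" and r: "2 \<le> r" "r \<le> m" "r + absorb_cost r < L" "L \<le> r + absorb_cost r + 12"
    and N: "m + size_bound ms + 2 \<le> sum_mset V"
    and rest: "\<And>N' c. L = c + r + absorb_cost r \<Longrightarrow> admissible ms N' (m - r) (V - {#L#}) (add_mset c D) \<Longrightarrow>
      bins_realizable N' ms (m - r) (V - {#L#}) (add_mset c D)"
  shows "bins_realizable N ms m V D"
proof -
  obtain V' where V: "V = add_mset L V'" using L by (metis insert_DiffM)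
  let ?g = "absorb_cost r"
  note g = absorb_cost_bounds[of r]
  define c where "c = L - r - ?g"
  have Lc: "L = c + r + ?g" "c \<ge> 1" "c \<le> 12" using r by (auto simp: c_def)
  have par: "odd c \<longleftrightarrow> odd L" using absorb_cost_even[of r] Lc(1) by (metis add.assoc even_add)
  have N2: "N \<ge> 2" using ok N by (auto simp: admissible_def size_bound_def)
  have "admissible ms (N - ?g) (m - r) (V - {#L#}) (add_mset c D)"
    using ok N2 V Lc par g r by (auto simp: admissible_def even_type_add)
  from rest[OF Lc(1) this] have "bins_realizable (N - ?g) ms (m - r) V' (add_mset c D)" using V by simp
  from bins_realizable_absorb[OF this r(1)] have "bins_realizable N ms m V' (add_mset L D)" using N2 Lc g r by (simp add: add.commute)
  then show ?thesis using bins_realizable_forget V by simp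
qed

text \<open>With at most three cycles of each length the total is at most
  \<open>3 * (1 + 2 + 3 + 4) = 30\<close>.\<close>

lemma four_equal_small_cycles:
  assumes "\<forall>l\<in>#V. 1 \<le> l \<and> l \<le> 4" "31 \<le> sum_mset V"
  obtains l V' where "l \<in> {1, 2, 3, 4 :: nat}" "V = replicate_mset 4 l + V'"
proof -
  have "\<exists>l\<in>{1, 2, 3, 4}. 4 \<le> count V l"
  proof (rule ccontr)
    assume c: "\<not> ?thesis"
    let ?M = "replicate_mset 3 1 + replicate_mset 3 2 + replicate_mset 3 3 + replicate_mset 3 (4 :: nat)"
    have "V \<subseteq># ?M"
    proof (rule mset_subset_eqI)
      fix l
      consider "l \<in> {1, 2, 3, 4}" | "l \<notin># V" using assms(1) by force
      then show "count V l \<le> count ?M l" using c by cases (auto simp: not_in_iff)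
    qed
    then obtain M' where "?M = V + M'" by (metis subset_mset.less_eqE)
    from arg_cong[OF this, of sum_mset] show False using assms(2) by simp
  qed
  then obtain l where l: "l \<in> {1, 2, 3, 4}" "4 \<le> count V l" by blast
  then have "replicate_mset 4 l \<subseteq># V" by (simp add: count_le_replicate_mset_subset_eq)
  then show thesis using that[OF l(1)] by (metis subset_mset.less_eqE)
qed

text \<open>The free points are filled two at a time, or three when exactly three are left, so that
  a single free point never remains. If no cycle is long enough for absorption, all lengths are at
  most 4 and four equal cycles can be found.\<close>

lemma fill_small:
  assumes "always_realizable ms"
  shows "admissible ms N m V D \<Longrightarrow>
    m \<le> 14 \<Longrightarrow> m \<noteq> 1 \<Longrightarrow> m + size_bound ms + 14 * m + 40 \<le> sum_mset V \<Longrightarrow> bins_realizable N ms m V D"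
proof (induction m arbitrary: N V D rule: less_induct)
  case (less m)
  show ?case
  proof (cases "m = 0")
    case True
    then show ?thesis using always_realizable_all_small[OF assms] less.prems by simp
  next
    case False
    define r where "r = (if m = 3 then 3 else 2 :: nat)"
    have r: "r = 2 \<or> r = 3" "r \<le> m" "m - r \<noteq> 1" "m - r < m" "r = 3 \<Longrightarrow> m = 3"
      using False less.prems(3) by (auto simp: r_def split: if_splits)
    have Nb: "N \<ge> 41" using less.prems(1,4) by (auto simp: admissible_def size_bound_def)
    \<comment> \<open>The threshold contains \<open>15 * m\<close> in all and drops by at least 30
      as \<open>r \<ge> 2\<close>; this pays for the cycles that a step uses up.\<close>
    have IH: "bins_realizable N' ms (m - r) V' D'" if "admissible ms N' (m - r) V' D'" "sum_mset V \<le> sum_mset V' + 30" for N' V' D'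
      by (rule less.IH) (use r that less.prems in auto)
    consider (big) L where "L \<in># V" "m + 3 \<le> L" | (mid) L where "L \<in># V" "5 \<le> L" "L \<le> m + 2"
      | (small) "\<forall>L\<in>#V. L \<le> 4"
      by force
    then show ?thesis
    proof cases
      case big
      show ?thesis by (rule absorb_last[OF assms less.prems(1) big]) (use False less.prems in auto)
    next
      case mid
      \<comment> \<open>Two points cost 2 and three points cost 1, so length 5 suffices in both
        cases. With \<open>L \<le> m + 2 \<le> 16\<close> the rest is at most 12, which is the
        origin of the bound on \<open>D\<close>.\<close>
      have rc: "r + absorb_cost r = 4" using r by (auto simp: absorb_cost_def)
      show ?thesis
      proof (rule absorb_part[OF less.prems(1) mid(1)])
        show "2 \<le> r" "r \<le> m" "r + absorb_cost r < L" "L \<le> r + absorb_cost r + 12"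
          using r rc mid less.prems by auto
        show "m + size_bound ms + 2 \<le> sum_mset V" using less.prems(4) by simp
        fix N' c assume c: "admissible ms N' (m - r) (V - {#L#}) (add_mset c D)"
        have "sum_mset V = L + sum_mset (V - {#L#})"
          using mid(1) by (rule sum_mset_remove)
        then show "bins_realizable N' ms (m - r) (V - {#L#}) (add_mset c D)"
          using IH[OF c] mid less.prems(2) by simp
      qed
    next
      case small
      have "\<forall>l\<in>#V. 1 \<le> l \<and> l \<le> 4"
      proof
        fix l assume l: "l \<in># V"
        have "0 \<notin># V" using less.prems(1) even_type_0[of "V + D"] by (auto simp: admissible_def)
        then have "l \<noteq> 0" using l by metis
        then show "1 \<le> l \<and> l \<le> 4" using small l by simp
      qed
      then obtain l V' where l: "l \<in> {1, 2, 3, 4}" "V = replicate_mset 4 l + V'"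
        using four_equal_small_cycles[of V] less.prems(4) by auto
      have V4: "V = add_mset l (add_mset l (add_mset l (add_mset l V')))" using l(2) by (simp add: numeral_eq_Suc)
      have m: "m = (m - r) + r" using r by simp
      \<comment> \<open>Two points are taken by two fixed points or an equal pair. Three points are
        taken by odd cycles as \<open>1 + 1 + 1\<close> or \<open>3\<close>; for
        \<open>l = 2\<close> and \<open>l = 4\<close>, eight points are shared as
        \<open>3 + 5\<close> with the main bin.\<close>
      consider "r = 2" "l = 1" | "r = 2" "2 \<le> l" | "r = 3" "l = 1 \<or> l = 3" | "r = 3" "l = 2" | "r = 3" "l = 4"
        using r(1) l(1) by auto
      then show ?thesis
      proof cases
        case 1
        have "admissible ms N (m - r) (add_mset l (add_mset l V')) D"
          using less.prems(1) V4 1 r by (auto simp: admissible_def even_type_add)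
        note q = bins_realizable_odd[OF bins_realizable_odd[OF IH[OF this], of 1], of 1]
        have "m - r + 1 + 1 = m" using 1 r by simp
        from q[unfolded this] show ?thesis using V4 1 by simp
      next
        case 2
        have "admissible ms (N - (2 * l - 2)) (m - r) (add_mset l (add_mset l V')) D"
          using less.prems(1) V4 2 r Nb l(1) by (auto simp: admissible_def even_type_add)
        note q = bins_realizable_equal_pair[OF IH[OF this] 2(2)]
        have "m - r + 2 = m" "N - (2 * l - 2) + (2 * l - 2) = N" using 2 r Nb l(1) by auto
        from q[unfolded this] show ?thesis using V4 l(1) by auto
      next
        case 3
        from 3(2) show ?thesis
        proof
          assume l1: "l = 1"
          have "admissible ms N (m - r) (add_mset l V') D"
            using less.prems(1) V4 3 r l1 by (auto simp: admissible_def even_type_add)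
          from bins_realizable_odd[OF bins_realizable_odd[OF bins_realizable_odd[OF IH[OF this], of 1], of 1], of 1] show ?thesis
            using V4 3 r l1 by (simp add: numeral_3_eq_3)
        next
          assume l3: "l = 3"
          have "admissible ms N (m - r) (add_mset l (add_mset l (add_mset l V'))) D"
            using less.prems(1) V4 3 r l3 by (auto simp: admissible_def even_type_add)
          from bins_realizable_odd[OF IH[OF this], of 3] show ?thesis using V4 3 r l3 by simp
        qed
      next
        case 4
        have "admissible ms (N - 5) (m - r) V' D"
          using less.prems(1) V4 4 r Nb by (auto simp: admissible_def even_type_add)
        from bins_realizable_four_transpositions[OF IH[OF this]] show ?thesis using V4 l(2) 4 r Nb by simp
      next
        case 5
        have "admissible ms (N - 5) (m - r) (add_mset l (add_mset l V')) D"
          using less.prems(1) V4 5 r Nb by (auto simp: admissible_def even_type_add)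
        from bins_realizable_four_pair[OF IH[OF this]] show ?thesis using V4 5 r Nb by simp
      qed
    qed
  qed
qed

text \<open>What is left of a bin of size \<open>m\<close> after absorbing all but 1 to 3 points of a cycle of length \<open>L \<le> m + 2\<close>;
  the value 1 is avoided, since a bin with a single free point cannot absorb anything.\<close>

definition residue :: "nat \<Rightarrow> nat \<Rightarrow> nat" where
  "residue m L = (if L = m + 2 then 2 else m + 3 - L)"

text \<open>The cycle fills all but at least 2 of the points it could fill, or nearly exhausts
  itself: it exceeds the number of points filled by at most 4. The second premise of
  \<open>cont\<close> records this loss for the accounting.\<close>

lemma absorb_whole:
  assumes ok: "admissible ms N m V D" and L: "L \<in># V" and lb: "7 \<le> L" "L \<le> m + 2"
    and N: "m + size_bound ms + 2 \<le> sum_mset V"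
    and cont: "\<And>N' c. admissible ms N' (residue m L) (V - {#L#}) (add_mset c D) \<Longrightarrow>
      sum_mset V + residue m L \<le> sum_mset (V - {#L#}) + m + 4 \<Longrightarrow>
      bins_realizable N' ms (residue m L) (V - {#L#}) (add_mset c D)"
  shows "bins_realizable N ms m V D"
proof -
  define r where "r = m - residue m L"
  have r: "m - r = residue m L" "2 \<le> r" "r \<le> m" "r + absorb_cost r < L" "L \<le> r + 4"
    using lb absorb_cost_bounds[of r] by (auto simp: r_def residue_def absorb_cost_def)
  have sm: "sum_mset V = L + sum_mset (V - {#L#})" using L by (rule sum_mset_remove)
  show ?thesis
    by (rule absorb_part[OF ok L r(2-4) _ N]) (use r sm cont in auto)
qed

text \<open>Cycles are packed into the bin as long as they fit. Once none fits, each odd cycle has length at least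
  \<open>m - 1\<close> and each pair of even cycles has total length at least \<open>m - 1\<close>, so absorbing at most two of
  them leaves a residue of bounded size.\<close>

lemma fill_bin:
  assumes "always_realizable ms"
  shows "admissible ms N m V D \<Longrightarrow>
    m \<noteq> 1 \<Longrightarrow> m + size_bound ms + 250 \<le> sum_mset V \<Longrightarrow> bins_realizable N ms m V D"
proof (induction m arbitrary: N V D rule: less_induct)
  case (less m)
  \<comment> \<open>For a bin of size at most 14 this asks for no more than
    \<open>14 * 14 + 40 = 236\<close> beyond \<open>m + size_bound ms\<close>; the allowance 250
    leaves room for a loss of at most 4 in each of two absorptions.\<close>
  note small = fill_small[OF assms]
  consider (small) "m \<le> 14" | (big) L where "m > 14" "L \<in># V" "m + 3 \<le> L"
    | (odd) L where "m > 14" "L \<in># V" "odd L" "L \<le> m - 2"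
    | (odd') L where "m > 14" "L \<in># V" "m - 1 \<le> L" "L \<le> m + 2"
    | (even) "m > 14" "\<forall>L\<in>#V. even L \<and> L \<le> m + 2"
    by fastforce
  then show ?case
  proof cases
    case small
    then show ?thesis using fill_small[OF assms less.prems(1) small] less.prems by simp
  next
    case big
    show ?thesis by (rule absorb_last[OF assms less.prems(1) big(2,3)]) (use big less.prems in auto)
  next
    case odd
    obtain V' where V: "V = add_mset L V'" using odd(2) by (metis insert_DiffM)
    have "admissible ms N (m - L) V' D" using less.prems(1) V odd by (auto simp: admissible_def even_type_add)
    then have "bins_realizable N ms (m - L) V' D"
      by (intro less.IH) (use odd less.prems V in \<open>auto elim: oddE\<close>)
    from bins_realizable_odd[OF this odd(3)] show ?thesis using V odd by simp
  next
    case odd'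
    \<comment> \<open>As \<open>L\<close> lies between \<open>m - 1\<close> and
      \<open>m + 2\<close>, the residue is between 2 and 4, within reach of
      \<open>fill_small\<close>.\<close>
    show ?thesis
      by (rule absorb_whole[OF less.prems(1) odd'(2)])
        (use odd' less.prems in \<open>auto intro!: small simp: residue_def split: if_splits\<close>)
  next
    case even
    obtain a V1 where a: "V = add_mset a V1" using less.prems(3) even(1)
      by (metis multiset_cases sum_mset.empty add_is_0 le_zero_eq not_numeral_le_zero)
    have "V1 \<noteq> {#}" using less.prems(3) even a by auto
    then obtain b V2 where b: "V1 = add_mset b V2" by (meson multiset_cases)
    have "\<exists>a b V2. V = add_mset a (add_mset b V2) \<and> b \<le> a"
      using a b by (metis add_mset_commute nle_le)
    then obtain a b V2 where V: "V = add_mset a (add_mset b V2)" and ba: "b \<le> a" by blast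
    have ev: "even a" "even b" "a \<le> m + 2" using V even by auto
    have pos: "a > 0" "b > 0" using less.prems(1) V by (auto simp: admissible_def even_type_add)
    show ?thesis
    proof (cases "a + b \<le> m - 2")
      case True
      have "admissible ms N (m - (a + b)) V2 D"
        using less.prems(1) V True ev even(1) by (auto simp: admissible_def even_type_add)
      then have "bins_realizable N ms (m - (a + b)) V2 D"
        by (intro less.IH) (use True even(1) less.prems V pos in auto)
      from bins_realizable_even[OF this ev(1,2) pos] show ?thesis using V True even(1) by simp
    next
      case False
      \<comment> \<open>\<open>a\<close> is the larger of the two, and
        \<open>a + b \<ge> m - 1 \<ge> 14\<close>.\<close>
      have a7: "7 \<le> a" using False ba even(1) by linarith
      show ?thesis
      proof (rule absorb_whole[OF less.prems(1) _ a7 ev(3)])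
        show "a \<in># V" using V by simp
        show "m + size_bound ms + 2 \<le> sum_mset V" using less.prems(3) by simp
        fix N' c
        let ?m = "residue m a" and ?V = "V - {#a#}" and ?D = "add_mset c D"
        assume ok: "admissible ms N' ?m ?V ?D" and "sum_mset V + ?m \<le> sum_mset ?V + m + 4"
        then have sum: "?m + size_bound ms + 246 \<le> sum_mset ?V" using less.prems(3) by simp
        \<comment> \<open>Since \<open>a + b \<ge> m - 1\<close>, the free space
          \<open>m + 3 - a\<close> left by \<open>a\<close> is at most \<open>b + 4\<close>; hence
          \<open>b\<close> can fill it up or leave little of it.\<close>
        have m: "2 \<le> ?m" "?m \<le> b + 4" using False ev(3) even(1) by (auto simp: residue_def)
        have bV: "b \<in># ?V" using V by simp
        consider "?m \<le> 14" | "?m + 3 \<le> b" | "?m > 14" "b \<le> ?m + 2" by linarith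
        then show "bins_realizable N' ms ?m ?V ?D"
        proof cases
          case 1
          then show ?thesis using small[OF ok] m sum by simp
        next
          case 2
          show ?thesis by (rule absorb_last[OF assms ok bV 2 m(1)]) (use sum in simp)
        next
          case 3
          show ?thesis
          proof (rule absorb_whole[OF ok bV _ 3(2)])
            show "7 \<le> b" using 3 m by simp
            show "?m + size_bound ms + 2 \<le> sum_mset ?V" using sum by simp
            fix N'' c'
            assume ok': "admissible ms N'' (residue ?m b) (?V - {#b#}) (add_mset c' ?D)"
              and s: "sum_mset ?V + residue ?m b \<le> sum_mset (?V - {#b#}) + ?m + 4"
            \<comment> \<open>From \<open>?m \<le> b + 4\<close> one gets
              \<open>?m + 3 - b \<le> 7\<close>.\<close>
            have "2 \<le> residue ?m b" "residue ?m b \<le> 7" using 3 m by (auto simp: residue_def[of ?m])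
            then show "bins_realizable N'' ms (residue ?m b) (?V - {#b#}) (add_mset c' ?D)"
              using small[OF ok'] s sum by simp
          qed
        qed
      qed
    qed
  qed
qed

section \<open>Induction over the list of bins\<close>

lemma always_realizable_Nil: "always_realizable []"
  unfolding always_realizable_def
proof (intro allI impI)
  fix N V D b
  assume e: "even_type (add_mset b V + D)" and N: "N + sum_list [] = sum_mset V + sum_mset D + b"
  have "realizable ((\<lambda>_. 0)(0 := N)) 1 {#} (V + add_mset b D)"
    using realizable_main[OF e, of 1] N by (simp add: add.assoc add.commute)
  then have "realizable ((\<lambda>_. 0)(0 := N)) 1 V (add_mset b D)" using realizable_forget_mset by fastforce
  moreover have "(sizes N [])(Suc 0 := 0) = (\<lambda>_. 0)(0 := N)" by (auto simp: sizes_def)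
  ultimately show "bins_realizable N [] 0 V (add_mset b D)" by (simp add: bins_realizable_def)
qed

text \<open>A distinguished cycle with \<open>b \<ge> 3\<close> takes the bin by two of its points.
  A shorter one joins \<open>D\<close>, and \<open>V\<close> supplies a fixed point, a cycle of
  length at least 3 or, if all its lengths are 2, two transpositions.\<close>

lemma always_realizable_append_1:
  assumes "always_realizable ms"
  shows "always_realizable (ms @ [1])"
  unfolding always_realizable_def
proof (intro allI impI)
  fix N V D b
  assume e: "even_type (add_mset b V + D)" and D: "\<forall>d\<in>#D. d \<le> 12"
    and N: "N + sum_list (ms @ [1]) = sum_mset V + sum_mset D + b"
    and bd: "size_bound (ms @ [1]) \<le> sum_mset V + b"
  have bd': "size_bound ms + 261 \<le> sum_mset V + b" using bd by (simp add: size_bound_def)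
  have N0: "N \<ge> 200" using N bd by (simp add: size_bound_def)
  show "bins_realizable N (ms @ [1]) 0 V (add_mset b D)"
  proof (cases "b \<ge> 3")
    case True
    have "bins_realizable (N - 1) ms 0 V (add_mset (b - 2) D)"
      by (rule always_realizableD[OF assms _ D]) (use e True N N0 bd' in \<open>auto simp: even_type_add\<close>)
    moreover have "b - 2 + 2 = b" "N - 1 + 1 = N" using True N0 by simp_all
    ultimately show ?thesis using bins_realizable_absorb_new by metis
  next
    case False
    let ?D = "add_mset b D"
    have ok: "admissible ms N 1 V ?D" using e D N False by (simp add: admissible_def)
    have s: "size_bound ms + 259 \<le> sum_mset V" using bd' False by simp
    have pos: "0 \<notin># V" using e by (auto simp: even_type_def)
    consider "1 \<in># V" | L where "L \<in># V" "3 \<le> L" | "\<forall>L\<in>#V. L = 2"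
    proof -
      have "L = 1 \<or> 3 \<le> L \<or> L = 2" if "L \<in># V" for L
        using pos that by (cases "L = 0") auto
      then show thesis using that by metis
    qed
    then show ?thesis
    proof cases
      case 1
      then obtain V' where V: "V = add_mset 1 V'" by (metis insert_DiffM)
      have "bins_realizable N ms 0 V' ?D"
        by (rule always_realizable_all_small[OF assms]) (use ok s V in \<open>auto simp: admissible_def even_type_add\<close>)
      from bins_realizable_append[OF bins_realizable_odd[OF this, of 1]] show ?thesis using V by simp
    next
      case 2
      then obtain V' where V: "V = add_mset L V'" by (metis insert_DiffM)
      have "bins_realizable (N - 1) ms 0 V' (add_mset (L - 2) ?D)"
        by (rule always_realizableD[OF assms]) (use ok s V 2 N0 in \<open>auto simp: admissible_def even_type_add\<close>)
      moreover have "L - 2 + 2 = L" "N - 1 + 1 = N" using 2 N0 by simp_all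
      ultimately show ?thesis using bins_realizable_forget bins_realizable_absorb_new V by metis
    next
      case 3
      obtain a V1 where a: "V = add_mset a V1" using s
        by (cases V) auto
      have "V1 \<noteq> {#}" using s 3 a by auto
      then obtain b' V2 where b': "V1 = add_mset b' V2" by (meson multiset_cases)
      have V: "V = add_mset 2 (add_mset 2 V2)" using a b' 3 by auto
      have "bins_realizable (N - 3) ms 0 V2 ?D"
        by (rule always_realizable_all_small[OF assms]) (use ok s V N0 in \<open>auto simp: admissible_def even_type_add\<close>)
      from bins_realizable_new_transpositions[OF this] show ?thesis using V N0 by simp
    qed
  qed
qed

lemma always_realizable_append:
  assumes "always_realizable ms" "m \<ge> 2"
  shows "always_realizable (ms @ [m])"
  unfolding always_realizable_def
proof (intro allI impI)
  fix N V D b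
  assume e: "even_type (add_mset b V + D)" and D: "\<forall>d\<in>#D. d \<le> 12"
    and N: "N + sum_list (ms @ [m]) = sum_mset V + sum_mset D + b"
    and bd: "size_bound (ms @ [m]) \<le> sum_mset V + b"
  have bd': "m + size_bound ms + 260 \<le> sum_mset V + b" using bd by (simp add: size_bound_def)
  have N0: "N \<ge> 200" using N bd by (simp add: size_bound_def)
  show "bins_realizable N (ms @ [m]) 0 V (add_mset b D)"
  proof (rule bins_realizable_append, cases "b \<le> 6")
    case True
    show "bins_realizable N ms m V (add_mset b D)"
      by (rule fill_bin[OF assms(1)]) (use True e D N bd' assms(2) in \<open>auto simp: admissible_def\<close>)
  next
    case False
    \<comment> \<open>\<open>b\<close> may be too long for \<open>D\<close>, so it is shortened
      before \<open>fill_bin\<close> can apply. If it can fill the whole bin, its rest remains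
      distinguished; otherwise it leaves at least 2 free points and a rest of at most 3, which joins
      \<open>D\<close>.\<close>
    define r where "r = (if m + 3 \<le> b then m else m - residue m b)"
    define c where "c = b - r - absorb_cost r"
    have r: "2 \<le> r" "r \<le> m" and b: "b = c + r + absorb_cost r" "c \<ge> 1"
      using False assms(2) absorb_cost_bounds[of r] by (auto simp: r_def c_def residue_def)
    have par: "odd c \<longleftrightarrow> odd b" using absorb_cost_even[of r] b(1) by (metis add.assoc even_add)
    have e': "even_type (add_mset c V + D)" using e b par by (auto simp: even_type_add)
    have N': "N - absorb_cost r + sum_list ms + (m - r) = sum_mset V + sum_mset D + c"
      using N N0 b r absorb_cost_bounds[of r] by simp
    have "bins_realizable (N - absorb_cost r) ms (m - r) V (add_mset c D)"
    proof (cases "m + 3 \<le> b")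
      case True
      then have "m - r = 0" "absorb_cost r \<le> 2" using absorb_cost_bounds by (auto simp: r_def)
      then show ?thesis using always_realizableD[OF assms(1) e' D] N' bd' b r by simp
    next
      case b': False
      have "m - r \<ge> 2" "b \<le> r + 4" using False b' by (auto simp: r_def residue_def)
      moreover from this have "c \<le> 12" using b(1) by simp
      ultimately show ?thesis
        by (intro fill_bin[OF assms(1)]) (use e' D N' bd' r in \<open>auto simp: admissible_def\<close>)
    qed
    from bins_realizable_absorb[OF this r(1)] show "bins_realizable N ms m V (add_mset b D)"
      using r b N0 absorb_cost_bounds[of r] by simp
  qed
qed

lemma always_realizable_positive: "0 \<notin> set ms \<Longrightarrow> always_realizable ms"
proof (induction ms rule: rev_induct)
  case Nil
  show ?case by (rule always_realizable_Nil)
next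
  case (snoc m ms)
  then show ?case using always_realizable_append_1[of ms] always_realizable_append[of ms m] by (cases "m = 1") auto
qed

text \<open>As \<open>sum_mset V = N + sum_list ms\<close>, the bound on \<open>N\<close> amounts to
  \<open>size_bound ms \<le> sum_mset V\<close>.\<close>

theorem realizable_exists:
  assumes "0 \<notin> set ms" "even_type V" "N + sum_list ms = sum_mset V" "260 * length ms + 1 \<le> N"
  shows "realizable (sizes N ms) (Suc (length ms)) V {#}"
proof -
  have "bins_realizable N ms 0 V {#}"
    by (rule always_realizable_all_small[OF always_realizable_positive[OF assms(1)]]) (use assms in \<open>auto simp: admissible_def size_bound_def\<close>)
  then show ?thesis by (simp add: bins_realizable_def fun_upd_idem)
qed

section \<open>Squares of conjugacy classes with few cycles\<close>

lemma sum_mset_set_fibres: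
  assumes "finite X" "finite J"
  shows "(\<Sum>j\<in>J. mset_set {x\<in>X. r x = j}) = mset_set {x\<in>X. r x \<in> J}"
  using assms(2)
proof (induction J rule: finite_induct)
  case (insert j J)
  have "{x\<in>X. r x \<in> insert j J} = {x\<in>X. r x = j} \<union> {x\<in>X. r x \<in> J}" by auto
  moreover have "{x\<in>X. r x = j} \<inter> {x\<in>X. r x \<in> J} = {}" using insert.hyps by auto
  ultimately show ?case using insert assms(1) by (simp add: mset_set_Union)
qed simp

lemma bins_cycle_type_dec:
  assumes b: "bins s X r" and fin: "finite X"
  obtains R where "cycle_type_dec s X R"
    "image_mset length R = image_mset (\<lambda>j. card {x\<in>X. r x = j}) (mset_set (r ` X))"
proof -
  have "\<forall>j\<in>r ` X. \<exists>xs. cyc s xs \<and> set xs = {x\<in>X. r x = j}"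
    using b unfolding bins_def by blast
  then obtain f where f: "\<And>j. j \<in> r ` X \<Longrightarrow> cyc s (f j) \<and> set (f j) = {x\<in>X. r x = j}"
    by metis
  let ?R = "image_mset f (mset_set (r ` X))"
  have m: "mset (f j) = mset_set {x\<in>X. r x = j}" if "j \<in> r ` X" for j
    using f[OF that] by (metis cyc_def mset_set_set)
  have "(\<Sum>w\<in>#?R. mset w) = (\<Sum>j\<in>r ` X. mset (f j))"
    by (simp add: sum_unfold_sum_mset image_mset.compositionality comp_def)
  also have "\<dots> = (\<Sum>j\<in>r ` X. mset_set {x\<in>X. r x = j})" by (intro sum.cong refl m)
  also have "\<dots> = mset_set {x\<in>X. r x \<in> r ` X}"
    using sum_mset_set_fibres[OF fin finite_imageI[OF fin]] .
  also have "{x\<in>X. r x \<in> r ` X} = X" by auto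
  finally have "cycle_type_dec s X ?R"
    using b f fin by (auto simp: cycle_type_dec_def bins_def)
  moreover have "image_mset length ?R = image_mset (\<lambda>j. card {x\<in>X. r x = j}) (mset_set (r ` X))"
    unfolding image_mset.compositionality comp_def
    using f fin by (intro image_mset_cong) (metis cyc_def distinct_card elem_mset_set finite_imageI)
  ultimately show thesis using that by blast
qed

lemma row_col_count_label:
  assumes "cycle_type_dec p X W"
  shows "row_count j (letters (image_mset (label r c) W)) = card {x\<in>X. r x = j}"
    "col_count j (letters (image_mset (label r c) W)) = card {x\<in>X. c x = j}"
proof -
  have eq: "letters (image_mset (label r c) W) = image_mset (\<lambda>x. (r x, c x)) (\<Sum>w\<in>#W. mset w)"
    by (induction W) (auto simp: label_def)
  have X: "(\<Sum>w\<in>#W. mset w) = mset_set X" "finite X" using assms by (simp_all add: cycle_type_dec_def)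
  show "row_count j (letters (image_mset (label r c) W)) = card {x\<in>X. r x = j}"
    "col_count j (letters (image_mset (label r c) W)) = card {x\<in>X. c x = j}"
    using X(2) unfolding eq X(1) row_count_def col_count_def
    by (simp_all add: filter_mset_image_mset)
qed

lemma map_permutation_apply_bij:
  assumes "bij_betw g X Y" "x \<in> X"
  shows "map_permutation X g s (g x) = g (s x)"
  using assms by (auto simp: map_permutation_def bij_betw_def)

lemma cycle_type_dec_transport:
  assumes d: "cycle_type_dec s X R" and g: "bij_betw g X Y"
  shows "cycle_type_dec (map_permutation X g s) Y (image_mset (map g) R)"
proof -
  let ?s = "map_permutation X g s"
  have fin: "finite X" and s: "s permutes X" using d by (simp_all add: cycle_type_dec_def)
  have "?s permutes Y" using map_permutation_permutes[OF g s] .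
  moreover have "cyc ?s (map g w)" if w: "w \<in># R" for w
  proof -
    have cw: "cyc s w" and wX: "set w \<subseteq> X"
      using d w cycle_type_dec_set[OF d w] by (auto simp: cycle_type_dec_def)
    have inj: "inj_on g (set w)" using g wX by (auto simp: bij_betw_def intro: inj_on_subset)
    have "successively (\<lambda>a b. ?s (g a) = g b) w"
    proof (rule successively_weaken[where P = "\<lambda>a b. s a = b"])
      show "successively (\<lambda>a b. s a = b) w" using cw by (simp add: cyc_def)
      fix a b assume ab: "a \<in> set (butlast w)" "s a = b"
      then have "a \<in> X" using in_set_butlastD wX by fast
      then show "?s (g a) = g b" using map_permutation_apply_bij[OF g] ab(2) by simp
    qed
    moreover have "last w \<in> X" using cw wX by (auto simp: cyc_def)
    ultimately show ?thesis using cw inj map_permutation_apply_bij[OF g]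
      by (auto simp: cyc_def successively_map distinct_map last_map hd_map)
  qed
  moreover have "(\<Sum>w\<in>#image_mset (map g) R. mset w) = image_mset g (\<Sum>w\<in>#R. mset w)"
    by (induction R) auto
  then have "(\<Sum>w\<in>#image_mset (map g) R. mset w) = mset_set Y"
    using d g by (simp add: cycle_type_dec_def image_mset_mset_set bij_betw_def)
  ultimately show ?thesis using fin g by (auto simp: cycle_type_dec_def bij_betw_def)
qed

lemma normal_subset_same_cycle_type:
  assumes A: "normal_subset n A" "p \<in> A" and p: "cycle_type_dec p {1..n} V" and q: "cycle_type_dec q {1..n} W"
    and len: "image_mset length V = image_mset length W"
  shows "q \<in> A"
proof -
  obtain g where g: "bij_betw g {1..n} {1..n}" "\<And>x. x \<in> {1..n} \<Longrightarrow> q (g x) = g (p x)"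
    using cycle_type_dec_bij[OF p q len] by metis
  \<comment> \<open>Extension by the identity makes \<open>g\<close> a permutation of all naturals,
    with a global inverse.\<close>
  define h where "h x = (if x \<in> {1..n} then g x else x)" for x
  have h: "h permutes {1..n}"
  proof (rule bij_imp_permutes)
    show "bij_betw h {1..n} {1..n}" using g(1) by (subst bij_betw_cong[of _ h g]) (simp_all add: h_def)
  qed (auto simp: h_def)
  have pp: "p permutes {1..n}" and qq: "q permutes {1..n}" using p q by (simp_all add: cycle_type_dec_def)
  have "q (h x) = h (p x)" for x
  proof (cases "x \<in> {1..n}")
    case True
    then show ?thesis using g(2) permutes_in_image[OF pp, of x] by (simp add: h_def)
  next
    case False
    then have "h x = x" "p x = x" "q x = x"
      using permutes_not_in[OF pp, of x] permutes_not_in[OF qq, of x] by (auto simp: h_def)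
    then show ?thesis by simp
  qed
  then have "q (h (inv h y)) = h (p (inv h y))" for y by simp
  then have "q = h \<circ> p \<circ> inv h" using permutes_inverses(1)[OF h] by (simp add: fun_eq_iff)
  then show ?thesis using A h by (simp add: normal_subset_def symgrp_def)
qed

lemma sum_length_cycle_type_dec:
  assumes "cycle_type_dec p X U"
  shows "sum_mset (image_mset length U) = card X"
proof -
  have "size (\<Sum>w\<in>#U. mset w) = sum_mset (image_mset length U)" by (induction U) auto
  then show ?thesis using assms unfolding cycle_type_dec_def by (metis size_mset_set)
qed

text \<open>The construction yields a product of the cycle type of \<open>t\<close> on some set
  \<open>X\<close>. A bijection onto \<open>{1..n}\<close> that carries this product to
  \<open>t\<close> itself carries the two factors to the required ones.\<close>

theorem class_square_contains:
  fixes n :: nat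
  assumes p: "cycle_type_dec p {1..n} V" and V: "image_mset length V = add_mset N (mset ms)"
    and N: "260 * length ms + 1 \<le> N" and t: "t permutes {1..n}" "evenperm t"
  obtains s s' R R' where "t = s \<circ> s'" "cycle_type_dec s {1..n} R" "cycle_type_dec s' {1..n} R'"
    "image_mset length R = image_mset length V" "image_mset length R' = image_mset length V"
proof -
  obtain W where W: "cycle_type_dec t {1..n} W" "even (n + size W)"
    using cycle_type_dec_exists[OF _ t(1)] t(2) by auto
  have pos: "0 \<notin># image_mset length U" if "cycle_type_dec q X U" for q :: "nat \<Rightarrow> nat" and X U
    using that by (auto simp: cycle_type_dec_def cyc_def)
  let ?L = "image_mset length W"
  have ms0: "0 \<notin> set ms" using pos[OF p] V by simp
  have "even_type ?L" using sum_length_cycle_type_dec[OF W(1)] pos[OF W(1)] W(2) by (simp add: even_type_def)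
  moreover have "N + sum_list ms = sum_mset ?L"
    using sum_length_cycle_type_dec[OF W(1)] sum_length_cycle_type_dec[OF p] V by (simp add: sum_mset_sum_list)
  ultimately have "realizable (sizes N ms) (Suc (length ms)) ?L {#}" using realizable_exists[OF ms0 _ _ N] by blast
  then obtain S where S: "state (sizes N ms) (Suc (length ms)) S {#}" "image_mset length S = ?L"
    by (auto simp: realizable_def)
  then have "reach S" and cnt: "has_counts (sizes N ms) (letters S)" by (simp_all add: state_def)
  from reach_realizes[OF this(1)] obtain X s s' r c W' where
    real: "realizes X s s' r c W'" "image_mset (label r c) W' = S" by blast
  have d: "cycle_type_dec (s \<circ> s') X W'" and b: "bins s X r" "bins s' X c"
    using real(1) by (simp_all add: realizes_def)
  have fin: "finite X" using d by (simp add: cycle_type_dec_def)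
  have "image_mset length W' = ?L"
    unfolding S(2)[symmetric] real(2)[symmetric] by (simp add: image_mset.compositionality comp_def label_def)
  then obtain g where g: "bij_betw g X {1..n}" "\<And>x. x \<in> X \<Longrightarrow> t (g x) = g ((s \<circ> s') x)"
    using cycle_type_dec_bij[OF d W(1)] by metis
  have rows: "card {x\<in>X. r x = j} = sizes N ms j" "card {x\<in>X. c x = j} = sizes N ms j" for j
    using row_col_count_label[OF d, of j r c] cnt real(2) by (simp_all add: has_counts_def)
  \<comment> \<open>No prescribed size is 0, so exactly the bins \<open>0\<close> to
    \<open>length ms\<close> occur, and their sizes form the cycle type of \<open>p\<close>.\<close>
  have nz: "sizes N ms j \<noteq> 0 \<longleftrightarrow> j \<le> length ms" for j
    using N ms0 by (auto simp: sizes_def in_set_conv_nth)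
  have img: "f ` X = {..length ms}" if "\<And>j. card {x\<in>X. f x = j} = sizes N ms j" for f
  proof -
    have "j \<in> f ` X \<longleftrightarrow> card {x\<in>X. f x = j} \<noteq> 0" for j using fin by auto
    then show ?thesis using that nz by auto
  qed
  have lens: "image_mset (sizes N ms) (mset_set {..length ms}) = image_mset length V"
  proof -
    have "mset_set {..length ms} = mset [0..<Suc (length ms)]"
      by (metis atLeast0AtMost atLeastLessThanSuc_atLeastAtMost mset_upt)
    moreover have "map (sizes N ms) [0..<Suc (length ms)] = N # ms"
      by (rule nth_equalityI) (auto simp: sizes_def nth_Cons' simp del: upt_Suc)
    ultimately show ?thesis using V by (metis mset.simps(2) mset_map)
  qed
  obtain R where R: "cycle_type_dec s X R" "image_mset length R = image_mset length V"
    using bins_cycle_type_dec[OF b(1) fin] unfolding rows img[OF rows(1)] lens by blast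
  obtain R' where R': "cycle_type_dec s' X R'" "image_mset length R' = image_mset length V"
    using bins_cycle_type_dec[OF b(2) fin] unfolding rows img[OF rows(2)] lens by blast
  let ?s = "map_permutation X g s" and ?s' = "map_permutation X g s'"
  have perm: "s permutes X" "s' permutes X" using b by (simp_all add: bins_def)
  have "t y = (?s \<circ> ?s') y" for y
  proof (cases "y \<in> {1..n}")
    case True
    then have "y \<in> g ` X" using g(1) by (simp add: bij_betw_def)
    then obtain x where x: "x \<in> X" "y = g x" by blast
    then show ?thesis
      using g permutes_in_image[OF perm(2), of x] by (simp add: map_permutation_apply_bij)
  next
    case False
    then show ?thesis using permutes_not_in[OF t(1), of y] g(1)
      by (auto simp: map_permutation_def bij_betw_def)
  qed
  then have "t = ?s \<circ> ?s'" by (simp add: fun_eq_iff)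
  moreover have "image_mset length (image_mset (map g) U) = image_mset length U" for U
    by (simp add: image_mset.compositionality comp_def)
  ultimately show thesis
    using that[OF _ cycle_type_dec_transport[OF R(1) g(1)] cycle_type_dec_transport[OF R'(1) g(1)]] R(2) R'(2)
    by simp
qed

section \<open>The longest cycle and the density estimate\<close>

lemma exists_large_element:
  fixes M :: "nat multiset"
  assumes "M \<noteq> {#}"
  obtains N M' where "M = add_mset N M'" "sum_mset M \<le> N * size M"
proof -
  define N where "N = Max (set_mset M)"
  have "N \<in># M" using assms by (simp add: N_def)
  then obtain M' where "M = add_mset N M'" by (metis insert_DiffM)
  moreover have "sum_mset M \<le> N * size M"
  proof -
    have "\<forall>x\<in>#M. x \<le> N" by (simp add: N_def)
    then show ?thesis by (induction M) auto
  qed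
  ultimately show thesis using that by blast
qed

theorem normal_square_contains:
  assumes A: "normal_subset n A" "p \<in> A" and p: "cycle_type_dec p {1..n} V"
    and k: "size V \<le> k" "261 * k * k \<le> n" "n \<ge> 1"
  shows "altgrp n \<subseteq> set_square A"
proof
  fix t assume "t \<in> altgrp n"
  then have t: "t permutes {1..n}" "evenperm t" by (simp_all add: altgrp_def symgrp_def)
  have sum: "sum_mset (image_mset length V) = n"
    using sum_length_cycle_type_dec[OF p] by simp
  then have "image_mset length V \<noteq> {#}" using k(3) by auto
  then obtain N M where N: "image_mset length V = add_mset N M" "n \<le> N * size V"
    using exists_large_element[of "image_mset length V"] sum by (metis size_image_mset)
  obtain ms where ms: "mset ms = M" using ex_mset by blast
  have len: "size V = Suc (length ms)" using arg_cong[OF N(1), of size] ms by auto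
  \<comment> \<open>Both sides are compared through \<open>n \<le> N * size V \<le> N * k\<close>.
    Cancelling \<open>k\<close> gives more than needed, since \<open>length ms\<close> is at most
    \<open>k - 1\<close>.\<close>
  have "261 * k * k \<le> N * k" using N(2) k(1,2) mult_le_mono2[OF k(1), of N] by linarith
  moreover have "k > 0" using len k(1) by simp
  ultimately have "261 * k \<le> N" by simp
  then have "260 * length ms + 1 \<le> N" using len k(1) by simp
  from class_square_contains[OF p _ this t, unfolded ms, OF N(1)]
  obtain s s' R R' where "t = s \<circ> s'" "cycle_type_dec s {1..n} R" "cycle_type_dec s' {1..n} R'"
    "image_mset length R = image_mset length V" "image_mset length R' = image_mset length V" by metis
  moreover from this have "s \<in> A" "s' \<in> A"
    using normal_subset_same_cycle_type[OF A p] by metis+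
  ultimately show "t \<in> set_square A" unfolding set_square_def by blast
qed

theorem theorem1p4:
  shows "\<forall>eps::real. eps > 0 \<longrightarrow> (\<exists>n0::nat. \<forall>n::nat. n > n0 \<longrightarrow>
    (\<forall>A. normal_subset n A \<and> density n A \<ge> exp (- (real n powr (2/5 - eps))) \<longrightarrow>
         altgrp n \<subseteq> set_square A))"
proof (intro allI impI)
  fix eps :: real assume eps: "eps > 0"
  \<comment> \<open>The exponent on the right is of order \<open>sqrt n\<close>, which outgrows
    \<open>n powr (2/5)\<close>; the \<open>- 1\<close> allows for rounding \<open>k\<close>
    down.\<close>
  have "\<forall>\<^sub>F n in sequentially. (real n + 1) * exp (real n powr (2/5)) < 2 powr (sqrt (real n) / 20 - 1)"
    by real_asymp
  then obtain n0 where n0: "\<And>n. n \<ge> n0 \<Longrightarrow> (real n + 1) * exp (real n powr (2/5)) < 2 powr (sqrt (real n) / 20 - 1)"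
    by (auto simp: eventually_sequentially)
  show "\<exists>n0::nat. \<forall>n::nat. n > n0 \<longrightarrow>
    (\<forall>A. normal_subset n A \<and> density n A \<ge> exp (- (real n powr (2/5 - eps))) \<longrightarrow>
         altgrp n \<subseteq> set_square A)"
  proof (intro exI[of _ n0] allI impI, elim conjE)
    fix n A
    assume n: "n > n0" and A: "normal_subset n A" and dens: "density n A \<ge> exp (- (real n powr (2/5 - eps)))"
    \<comment> \<open>The divisor 20 gives \<open>400 * k * k \<le> n\<close>, which covers the
      required factor 261.\<close>
    define k where "k = nat \<lfloor>sqrt (real n) / 20\<rfloor>"
    have k: "real k \<le> sqrt (real n) / 20" "sqrt (real n) / 20 - 1 \<le> real k"
    proof -
      have "real k = of_int \<lfloor>sqrt (real n) / 20\<rfloor>" by (simp add: k_def)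
      then show "real k \<le> sqrt (real n) / 20" "sqrt (real n) / 20 - 1 \<le> real k" by linarith+
    qed
    have "real k * real k \<le> (sqrt (real n) / 20) * (sqrt (real n) / 20)"
      by (intro mult_mono k) auto
    then have "real (400 * k * k) \<le> real n" by simp
    then have kk: "261 * k * k \<le> n" by linarith
    have Asub: "A \<subseteq> {p. p permutes {1..n}}" using A by (auto simp: normal_subset_def symgrp_def)
    have card_sym: "card (symgrp n) = fact n" using card_permutations[of "{1..n}" n] by (simp add: symgrp_def)
    let ?x = "real n powr (2/5)"
    have "real n powr (2/5 - eps) \<le> ?x" using n eps by (intro powr_mono) auto
    then have "exp (- ?x) \<le> density n A" using dens by (smt (verit) exp_le_cancel_iff)
    then have cA: "fact n * exp (- ?x) \<le> real (card A)"
      by (simp add: density_def card_sym field_simps)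
    have "\<exists>p\<in>A. p \<notin> many_cycles {1..n} k"
    proof (rule ccontr)
      assume "\<not> ?thesis"
      then have "A \<subseteq> many_cycles {1..n} k" by auto
      moreover have "finite (many_cycles {1..n} k)"
        by (rule finite_subset[OF _ finite_permutations[of "{1..n}"]]) (auto simp: many_cycles_def)
      ultimately have "card A \<le> card (many_cycles {1..n} k)" by (rule card_mono[rotated])
      then have "card A * 2 ^ k \<le> fact (Suc n)"
        using card_many_cycles[of "{1..n}" k] by (metis card_atLeastAtMost diff_Suc_1 finite_atLeastAtMost le_trans mult_le_mono1)
      then have "real (card A * 2 ^ k) \<le> real (fact (Suc n))" by (rule of_nat_mono)
      then have "real (card A) * 2 ^ k \<le> fact n * (real n + 1)" by (simp add: algebra_simps)
      moreover have "fact n * exp (- ?x) * 2 ^ k \<le> real (card A) * 2 ^ k"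
        by (intro mult_right_mono cA) simp
      ultimately have "fact n * exp (- ?x) * 2 ^ k \<le> fact n * (real n + 1)" by (rule order_trans[rotated])
      then have "fact n * (exp (- ?x) * 2 ^ k) \<le> fact n * (real n + 1)" by (simp only: mult.assoc)
      then have "exp (- ?x) * 2 ^ k \<le> real n + 1" by (subst (asm) mult_le_cancel_left_pos) simp_all
      then have "2 ^ k \<le> (real n + 1) * exp ?x" by (simp add: exp_minus field_simps)
      also have "\<dots> < 2 powr (sqrt (real n) / 20 - 1)" using n0[of n] n by simp
      also have "\<dots> \<le> 2 powr (real k)" using k(2) by simp
      finally show False by (simp add: powr_realpow)
    qed
    then obtain p where p: "p \<in> A" "p \<notin> many_cycles {1..n} k" by blast
    then obtain V where "cycle_type_dec p {1..n} V" "size V \<le> k"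
      using Asub by (auto simp: many_cycles_def not_less)
    then show "altgrp n \<subseteq> set_square A"
      using normal_square_contains[OF A p(1)] kk n by auto
  qed
qed

end
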